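(* Let $T$ be a generalised (mildly truncated) hyperbolic tetrahedron with dihedral angles $a_{ij}$ and edge lengths $\ell_{ij}$, $1\le i<j\le 4$. Then $$\mathrm{Jac}^{\star}(T):=\frac{\partial(\ell_{12}, \ell_{13}, \ell_{14}, \ell_{23}, \ell_{24}, \ell_{34})}{\partial(a_{12}, a_{13}, a_{14}, a_{23}, a_{24}, a_{34})} = -\eta\, \mathscr{D}\, \mathscr{S}\, \mathscr{D},$$ where $$\eta := \left( \frac{\prod_{i=1}^4 \varepsilon_i \det G_{ii}}{(-\det G)^3} \right)^{1/2},\qquad \mathscr{D} := \mathrm{diag}(\sigma_{12},\sigma_{13},\sigma_{14},\sigma_{23},\sigma_{24},\sigma_{34}),$$ $$\mathscr{S} := \left( \begin{array}{cccccc} \omega_{12}& \varepsilon_1 \sigma'_{14}& \varepsilon_1 \sigma'_{13}& \varepsilon_2 \sigma'_{24}& \varepsilon_2 \sigma'_{23}& 1\\ \varepsilon_1 \sigma'_{14}& \omega_{13}& \varepsilon_1 \sigma'_{12}& \varepsilon_3 \sigma'_{34}& 1& \varepsilon_3 \sigma'_{23}\\ \varepsilon_1 \sigma'_{13}& \varepsilon_1 \sigma'_{12}& \omega_{14}& 1& \varepsilon_4 \sigma'_{34}& \varepsilon_4 \sigma'_{24}\\ \varepsilon_2 \sigma'_{24}& \varepsilon_3 \sigma'_{34}& 1& \omega_{23}& \varepsilon_2 \sigma'_{12}& \varepsilon_3 \sigma'_{13}\\ \varepsilon_2 \sigma'_{23}& 1& \varepsilon_4 \sigma'_{34}& \varepsilon_2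 \sigma'_{12}& \omega_{24}& \varepsilon_4 \sigma'_{14}\\ 1& \varepsilon_3 \sigma'_{23}& \varepsilon_4 \sigma'_{24}& \varepsilon_3 \sigma'_{13}& \varepsilon_4 \sigma'_{14}& \omega_{34} \end{array} \right),$$ and, for $\{i,j,k,l\}=\{1,2,3,4\}$, $$\omega_{kl} := \frac{\sigma'_{ik}\sigma'_{jl} + \varepsilon_l \sigma'_{il}\sigma'_{jl}\sigma'_{kl} + \sigma'_{il}\sigma'_{jk} + \varepsilon_k \sigma'_{ik}\sigma'_{jk}\sigma'_{kl}}{\sigma_{kl}^2}.$$
   Context: A generalised hyperbolic tetrahedron $T$ is the (possibly truncated) tetrahedron in $\mathbb{H}^3$ determined by four vertices $\mathrm{v}_1,\dots,\mathrm{v}_4$ in the projective model, each of which is proper ($\mathrm{v}_k\in\mathbb{H}^3$), ideal ($\mathrm{v}_k\in\partial\mathbb{H}^3$), or ultra-ideal (so that it defines a polar hyperbolic plane). Put $\varepsilon_k=+1,0,-1$ respectively. At each ultra-ideal vertex $T$ is truncated by its polar plane. $T$ is mildly truncated if the truncating planes of its ultra-ideal vertices do not intersect. The edge $e_{ij}$ joins $\mathrm{v}_i$ and $\mathrm{v}_j$; $a_{ij}$ is the dihedral angle of $T$ along $e_{ij}$, and $\ell_{ij}$ is the length of $e_{ij}$ (of its part in $T$, i.e. cut off by the polar plane at an ultra-ideal end). Indices are symmetric: $a_{ij}=a_{ji}$, $\ell_{ij}=\ell_{ji}$. The Gram matrix $G$ of $T$ is the symmetric $4\times4$ matrix with $1$'s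 on the diagonal and $(i,j)$ entry $-\cos a_{kl}$ for $\{i,j,k,l\}=\{1,2,3,4\}$. $G_{ii}$ is the $3\times 3$ matrix obtained from $G$ by deleting row $i$ and column $i$. Finally $$\sigma_{kl}:=\tfrac12 e^{\ell_{kl}}-\tfrac12\varepsilon_k\varepsilon_l e^{-\ell_{kl}},\qquad \sigma'_{kl}:=\tfrac12 e^{\ell_{kl}}+\tfrac12\varepsilon_k\varepsilon_l e^{-\ell_{kl}},$$ again symmetric in the indices. The matrix $\frac{\partial(\ell_{12},\dots)}{\partial(a_{12},\dots)}$ is the Jacobian matrix of the edge lengths with respect to the dihedral angles, in the listed order.
   Formalization: In ω_kl the products σ'_ik σ'_jl and σ'_il σ'_jk carry minus signs, as the printed plus signs fail for the regular compact tetrahedron; all edge lengths are assumed finite (no ideal vertices or tangent truncating planes), and each polar plane separates its vertex from the others. *)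

theory Defs
  imports "HOL-Analysis.Analysis"
begin

text \<open>
  Hyperbolic space is the upper sheet of the hyperboloid in Minkowski space, and a point of
  projective space is given by a nonzero vector spanning the corresponding line.
\<close>

definition mink :: "real^4 \<Rightarrow> real^4 \<Rightarrow> real" where
  "mink x y = x$1 * y$1 + x$2 * y$2 + x$3 * y$3 - x$4 * y$4"

definition hyperbolic_space :: "(real^4) set" where
  "hyperbolic_space = {x. mink x x = -1 \<and> x$4 > 0}"

definition hyp_dist :: "real^4 \<Rightarrow> real^4 \<Rightarrow> real" where
  "hyp_dist x y = arcosh (- mink x y)"

text \<open>
  The value is \<open>1\<close>, \<open>0\<close>, \<open>-1\<close> if the \<open>k\<close>-th vertex is proper, ideal, ultra-ideal, respectively.
\<close>

definition vertex_sign :: "(4 \<Rightarrow> real^4) \<Rightarrow> 4 \<Rightarrow> real" where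
  "vertex_sign v k = - sgn (mink (v k) (v k))"

definition polar_plane :: "real^4 \<Rightarrow> (real^4) set" where
  "polar_plane u = {x \<in> hyperbolic_space. mink x u = 0}"

text \<open>
  Representatives of proper and ideal vertices are taken future-directed, so that the tetrahedron
  is the part of hyperbolic space inside the convex cone of the four representatives.
  The representative \<open>u\<close> of an ultra-ideal vertex has its sign chosen so that this vertex lies on
  the side \<open>mink x u > 0\<close> of its polar plane, which is the side cut off by the truncation.
  The last condition says that the polar plane of an ultra-ideal vertex separates it from the
  other vertices. It holds automatically for two vertices neither of which is ultra-ideal.
\<close>

definition generalised_tetrahedron :: "(4 \<Rightarrow> real^4) \<Rightarrow> bool" where
  "generalised_tetrahedron v \<longleftrightarrow>
     det (\<chi> k. v k) \<noteq> 0 \<and>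
     (\<forall>k. vertex_sign v k \<noteq> -1 \<longrightarrow> v k $ 4 > 0) \<and>
     (\<forall>i j. i \<noteq> j \<longrightarrow> mink (v i) (v j) < 0)"

definition mildly_truncated :: "(4 \<Rightarrow> real^4) \<Rightarrow> bool" where
  "mildly_truncated v \<longleftrightarrow>
     generalised_tetrahedron v \<and>
     (\<forall>i j. i \<noteq> j \<and> vertex_sign v i = -1 \<and> vertex_sign v j = -1 \<longrightarrow>
        polar_plane (v i) \<inter> polar_plane (v j) = {})"

definition truncated_tetrahedron :: "(4 \<Rightarrow> real^4) \<Rightarrow> (real^4) set" where
  "truncated_tetrahedron v =
     {x \<in> hyperbolic_space.
        (\<exists>c. (\<forall>k. c k \<ge> 0) \<and> x = (\<Sum>k\<in>UNIV. c k *\<^sub>R v k)) \<and>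
        (\<forall>k. vertex_sign v k = -1 \<longrightarrow> mink x (v k) \<le> 0)}"

definition edge_part :: "(4 \<Rightarrow> real^4) \<Rightarrow> 4 \<Rightarrow> 4 \<Rightarrow> (real^4) set" where
  "edge_part v i j =
     {x \<in> truncated_tetrahedron v. \<exists>s t. s \<ge> 0 \<and> t \<ge> 0 \<and> x = s *\<^sub>R v i + t *\<^sub>R v j}"

text \<open>
  The part of an edge inside the truncated tetrahedron is a geodesic arc, so its length is its
  diameter. It is \<open>\<infinity>\<close> if an end is ideal, and \<open>-\<infinity>\<close> in the limiting case in which the edge only
  touches the sphere at infinity, where the part is empty.
\<close>

definition edge_length :: "(4 \<Rightarrow> real^4) \<Rightarrow> 4 \<Rightarrow> 4 \<Rightarrow> ereal" where
  "edge_length v i j = (SUP x\<in>edge_part v i j. SUP y\<in>edge_part v i j. ereal (hyp_dist x y))"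

text \<open>
  For \<open>{i, j, k, l} = {1, 2, 3, 4}\<close> and symmetric \<open>f\<close> this is \<open>f k l\<close>.
\<close>

definition opposite :: "(4 \<Rightarrow> 4 \<Rightarrow> 'b) \<Rightarrow> 4 \<Rightarrow> 4 \<Rightarrow> 'b" where
  "opposite f i j = (THE y. \<exists>k l. {i, j, k, l} = UNIV \<and> y = f k l)"

lemma opposite_eq:
  assumes "\<And>k l. f k l = f l k" and "{i, j, k, l} = (UNIV :: 4 set)"
  shows "opposite f i j = f k l"
  unfolding opposite_def
proof (rule the_equality)
  show "\<exists>k' l'. {i, j, k', l'} = UNIV \<and> f k l = f k' l'"
    using assms(2) by blast
next
  fix y assume "\<exists>k' l'. {i, j, k', l'} = UNIV \<and> y = f k' l'"
  then obtain k' l' where kl: "{i, j, k', l'} = (UNIV :: 4 set)" and y: "y = f k' l'"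
    by blast
  have dist: "distinct [i, j, p, q]" if "{i, j, p, q} = (UNIV :: 4 set)" for p q
    using that card_distinct[of "[i, j, p, q]"] by simp
  have "{k, l} = UNIV - {i, j}" "{k', l'} = UNIV - {i, j}"
    using dist[OF assms(2)] dist[OF kl] assms(2) kl by auto
  then have "{k', l'} = {k, l}" by simp
  then show "y = f k l"
    using assms(1) y by (auto simp: doubleton_eq_iff)
qed

text \<open>
  The outward unit normal of the face opposite to the \<open>k\<close>-th vertex.
\<close>

definition outward_normal :: "(4 \<Rightarrow> real^4) \<Rightarrow> 4 \<Rightarrow> real^4" where
  "outward_normal v k =
     (THE u. mink u u = 1 \<and> (\<forall>j. j \<noteq> k \<longrightarrow> mink u (v j) = 0) \<and> mink u (v k) < 0)"

text \<open>
  The two faces containing the edge \<open>i j\<close> are the ones opposite to the two other vertices, and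
  the dihedral angle is \<open>pi\<close> minus the angle between their outward normals.
\<close>

definition dihedral_angle :: "(4 \<Rightarrow> real^4) \<Rightarrow> 4 \<Rightarrow> 4 \<Rightarrow> real" where
  "dihedral_angle v =
     opposite (\<lambda>k l. arccos (- mink (outward_normal v k) (outward_normal v l)))"

definition gram_matrix :: "(4 \<Rightarrow> 4 \<Rightarrow> real) \<Rightarrow> real^4^4" where
  "gram_matrix a = (\<chi> i j. if i = j then 1 else - cos (opposite a i j))"

definition principal_submatrix :: "real^4^4 \<Rightarrow> 4 \<Rightarrow> real^3^3" where
  "principal_submatrix A i =
     (let idx = vector (removeAll i [1, 2, 3, 4]) :: 4^3
      in \<chi> r c. A $ (idx $ r) $ (idx $ c))"

definition edge_vector :: "(4 \<Rightarrow> 4 \<Rightarrow> real) \<Rightarrow> real^6" where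
  "edge_vector f = vector [f 1 2, f 1 3, f 1 4, f 2 3, f 2 4, f 3 4]"

text \<open>
  The edge lengths as a function of the dihedral angles. The description is proper at every angle
  vector realised by a mildly truncated tetrahedron with finite edge lengths, since the dihedral
  angles determine such a tetrahedron up to isometry.
\<close>

definition edge_length_map :: "real^6 \<Rightarrow> real^6" where
  "edge_length_map \<alpha> =
     (THE x. \<exists>v L. mildly_truncated v \<and>
        (\<forall>i j. i \<noteq> j \<longrightarrow> edge_length v i j = ereal (L i j)) \<and>
        edge_vector (dihedral_angle v) = \<alpha> \<and> x = edge_vector L)"

text \<open>In the following, \<open>\<epsilon>\<close> stands for the vertex signs and \<open>L\<close> for the edge lengths.\<close>

definition sigma :: "(4 \<Rightarrow> real) \<Rightarrow> (4 \<Rightarrow> 4 \<Rightarrow> real) \<Rightarrow> 4 \<Rightarrow> 4 \<Rightarrow> real" where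
  "sigma \<epsilon> L k l = 1/2 * exp (L k l) - 1/2 * \<epsilon> k * \<epsilon> l * exp (- L k l)"

definition sigma' :: "(4 \<Rightarrow> real) \<Rightarrow> (4 \<Rightarrow> 4 \<Rightarrow> real) \<Rightarrow> 4 \<Rightarrow> 4 \<Rightarrow> real" where
  "sigma' \<epsilon> L k l = 1/2 * exp (L k l) + 1/2 * \<epsilon> k * \<epsilon> l * exp (- L k l)"

text \<open>
  The two products without a sign factor enter with a minus sign. In the source they are printed
  with a plus sign, which is a misprint: for a regular compact tetrahedron with
  \<open>c = cosh L\<close>, the derivative of the lengths along the diagonal direction forces
  \<open>omega = 2 * c^2 / (c + 1)\<close>, whereas plus signs would give \<open>2 * c^2 / (c - 1)\<close>.
\<close>

definition omega :: "(4 \<Rightarrow> real) \<Rightarrow> (4 \<Rightarrow> 4 \<Rightarrow> real) \<Rightarrow> 4 \<Rightarrow> 4 \<Rightarrow> real" where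
  "omega \<epsilon> L k l =
     opposite (\<lambda>i j. let s = sigma' \<epsilon> L in
       (- s i k * s j l + \<epsilon> l * s i l * s j l * s k l
        - s i l * s j k + \<epsilon> k * s i k * s j k * s k l) / (sigma \<epsilon> L k l)\<^sup>2) k l"

definition eta :: "(4 \<Rightarrow> real) \<Rightarrow> real^4^4 \<Rightarrow> real" where
  "eta \<epsilon> G = sqrt ((\<Prod>i\<in>UNIV. \<epsilon> i * det (principal_submatrix G i)) / (- det G) ^ 3)"

definition diag_matrix :: "real^6 \<Rightarrow> real^6^6" where
  "diag_matrix d = (\<chi> i j. if i = j then d $ i else 0)"

definition D_matrix :: "(4 \<Rightarrow> real) \<Rightarrow> (4 \<Rightarrow> 4 \<Rightarrow> real) \<Rightarrow> real^6^6" where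
  "D_matrix \<epsilon> L = diag_matrix (edge_vector (sigma \<epsilon> L))"

definition S_matrix :: "(4 \<Rightarrow> real) \<Rightarrow> (4 \<Rightarrow> 4 \<Rightarrow> real) \<Rightarrow> real^6^6" where
  "S_matrix \<epsilon> L = (let s = sigma' \<epsilon> L; w = omega \<epsilon> L in
     vector [
       vector [w 1 2,       \<epsilon> 1 * s 1 4, \<epsilon> 1 * s 1 3, \<epsilon> 2 * s 2 4, \<epsilon> 2 * s 2 3, 1          ],
       vector [\<epsilon> 1 * s 1 4, w 1 3,       \<epsilon> 1 * s 1 2, \<epsilon> 3 * s 3 4, 1,           \<epsilon> 3 * s 2 3],
       vector [\<epsilon> 1 * s 1 3, \<epsilon> 1 * s 1 2, w 1 4,       1,           \<epsilon> 4 * s 3 4, \<epsilon> 4 * s 2 4],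
       vector [\<epsilon> 2 * s 2 4, \<epsilon> 3 * s 3 4, 1,           w 2 3,       \<epsilon> 2 * s 1 2, \<epsilon> 3 * s 1 3],
       vector [\<epsilon> 2 * s 2 3, 1,           \<epsilon> 4 * s 3 4, \<epsilon> 2 * s 1 2, w 2 4,       \<epsilon> 4 * s 1 4],
       vector [1,           \<epsilon> 3 * s 2 3, \<epsilon> 4 * s 2 4, \<epsilon> 3 * s 1 3, \<epsilon> 4 * s 1 4, w 3 4      ]])"

end

theory Submission
  imports Defs
begin

text \<open>
  The dihedral angles determine the Gram matrix \<open>G\<close> of the outward unit normals of the faces, and
  its inverse \<open>H\<close> is, up to positive factors attached to the vertices, the Gram matrix of the
  vertices: the rows of \<open>G\<close> and \<open>H\<close> belong to dual bases of Minkowski space. A vertex is proper,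
  ideal or ultra-ideal according to the sign of \<open>H\<^sub>i\<^sub>i\<close>, and in the three combinations without
  an ideal end the length of an edge is one and the same expression,
  \<open>\<ell>\<^sub>i\<^sub>j = ln ((sqrt (H\<^sub>i\<^sub>j\<^sup>2 - p) - H\<^sub>i\<^sub>j) / sqrt \<bar>p\<bar>)\<close> with \<open>p = H\<^sub>i\<^sub>i H\<^sub>j\<^sub>j\<close>
  (\<open>edge_length_eq\<close>). It is homogeneous of degree \<open>0\<close>, so the unknown positive factors
  cancel. Ideal vertices are excluded by the finiteness of the lengths (\<open>edge_length_ideal\<close>).

  Hence the angles determine the lengths (\<open>lengths_from_angles\<close>). The function
  \<open>edge_length_map\<close> can be differentiated because the angle vectors that occur form an open set: they
  are characterised by strict inequalities for \<open>G\<close> and \<open>H\<close> (\<open>realisable\<close>). That these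
  inequalities suffice is shown by factorising \<open>G\<close> as a Gram matrix with respect to the
  Minkowski form (\<open>gram_factorisation\<close>), taking the dual basis as vertices, and choosing the
  time orientation (\<open>realisable_imp_tetrahedron\<close>).

  On this open set \<open>dH = - H dG H\<close>, and an angle occurs in only one pair of entries of \<open>G\<close>. With
  \<open>H\<^sub>i\<^sub>i = - \<epsilon>\<^sub>i h\<^sub>i\<^sup>2\<close> and \<open>H\<^sub>i\<^sub>j = - h\<^sub>i h\<^sub>j s\<^sub>i\<^sub>j\<close>, where \<open>s\<close> turns out to be \<open>sigma'\<close>, every
  partial derivative becomes \<open>\<eta> \<sigma>\<^sub>k\<^sub>l / \<sigma>\<^sub>p\<^sub>q\<close> times a polynomial in the \<open>s\<^sub>i\<^sub>j\<close> and \<open>\<epsilon>\<^sub>i\<close>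
  (\<open>J_eq\<close>); the factor \<open>\<eta>\<close> comes from Jacobi's identity for complementary minors, in the form
  \<open>sin\<^sup>2 a\<^sub>k\<^sub>l = - det G (H\<^sub>k\<^sub>l\<^sup>2 - H\<^sub>k\<^sub>k H\<^sub>l\<^sub>l)\<close>. The polynomial simplifies by
  \<open>s\<^sub>p\<^sub>q\<^sup>2 - \<sigma>\<^sub>p\<^sub>q\<^sup>2 = \<epsilon>\<^sub>p \<epsilon>\<^sub>q\<close> in three ways, for equal, adjacent and opposite edges.
\<close>

section \<open>The Minkowski form\<close>

lemma mink_commute: "mink x y = mink y x"
  by (simp add: mink_def algebra_simps)

lemma mink_linear [simp]:
  "mink (x + y) z = mink x z + mink y z" "mink z (x + y) = mink z x + mink z y"
  "mink (x - y) z = mink x z - mink y z" "mink z (x - y) = mink z x - mink z y"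
  "mink (c *\<^sub>R x) z = c * mink x z" "mink z (c *\<^sub>R x) = c * mink z x"
  "mink (- x) z = - mink x z" "mink z (- x) = - mink z x"
  "mink 0 z = 0" "mink z 0 = 0"
  by (simp_all add: mink_def algebra_simps)

lemma mink_sum_left: "mink (\<Sum>k\<in>A. f k) z = (\<Sum>k\<in>A. mink (f k) z)"
  by (induction A rule: infinite_finite_induct) auto

lemma mink_sum_right: "mink z (\<Sum>k\<in>A. f k) = (\<Sum>k\<in>A. mink z (f k))"
  by (induction A rule: infinite_finite_induct) auto

lemma mink_spatial_Cauchy_Schwarz:
  fixes x y :: "real^4"
  shows "(x$1 * y$1 + x$2 * y$2 + x$3 * y$3)\<^sup>2
    \<le> ((x$1)\<^sup>2 + (x$2)\<^sup>2 + (x$3)\<^sup>2) * ((y$1)\<^sup>2 + (y$2)\<^sup>2 + (y$3)\<^sup>2)"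
proof -
  have "((x$1)\<^sup>2 + (x$2)\<^sup>2 + (x$3)\<^sup>2) * ((y$1)\<^sup>2 + (y$2)\<^sup>2 + (y$3)\<^sup>2)
      - (x$1 * y$1 + x$2 * y$2 + x$3 * y$3)\<^sup>2
    = (x$1 * y$2 - x$2 * y$1)\<^sup>2 + (x$1 * y$3 - x$3 * y$1)\<^sup>2 + (x$2 * y$3 - x$3 * y$2)\<^sup>2"
    by algebra
  then show ?thesis
    by (smt (verit) zero_le_power2)
qed

lemma mink_le_imp: "mink x x \<le> 0 \<Longrightarrow> (x$1)\<^sup>2 + (x$2)\<^sup>2 + (x$3)\<^sup>2 \<le> (x$4)\<^sup>2"
  by (simp add: mink_def power2_eq_square)

text \<open>
  The form is positive definite on the orthogonal complement of a timelike vector, which follows from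
  the Cauchy-Schwarz inequality for the spatial coordinates.
\<close>

lemma spacelike_if_orthogonal_timelike:
  assumes e: "mink e e < 0" and o: "mink x e = 0" and "x \<noteq> 0"
  shows "mink x x > 0"
proof (rule ccontr)
  let ?X = "(x$1)\<^sup>2 + (x$2)\<^sup>2 + (x$3)\<^sup>2" and ?E = "(e$1)\<^sup>2 + (e$2)\<^sup>2 + (e$3)\<^sup>2"
  assume "\<not> mink x x > 0"
  then have X: "?X \<le> (x$4)\<^sup>2" by (intro mink_le_imp) simp
  have E: "?E < (e$4)\<^sup>2" using e by (simp add: mink_def power2_eq_square)
  have x4: "x$4 \<noteq> 0"
  proof
    assume "x$4 = 0"
    then have "?X \<le> 0" using X by simp
    then have "(x$1)\<^sup>2 = 0" "(x$2)\<^sup>2 = 0" "(x$3)\<^sup>2 = 0"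
      by (smt (verit) zero_le_power2)+
    then have "x = 0" using \<open>x$4 = 0\<close> by (simp add: vec_eq_iff forall_4)
    with \<open>x \<noteq> 0\<close> show False by simp
  qed
  have "(x$4 * e$4)\<^sup>2 = (x$1 * e$1 + x$2 * e$2 + x$3 * e$3)\<^sup>2"
    using o by (simp add: mink_def)
  also have "\<dots> \<le> ?X * ?E" by (rule mink_spatial_Cauchy_Schwarz)
  also have "\<dots> \<le> (x$4)\<^sup>2 * ?E" by (rule mult_right_mono[OF X]) simp
  also have "\<dots> < (x$4)\<^sup>2 * (e$4)\<^sup>2" using x4 E by simp
  finally show False by (simp add: power_mult_distrib)
qed

text \<open>
  With a fixed future-directed causal vector as reference, the sign of the product decides the time
  orientation, so that orientations can be read off from Gram matrices.
\<close>

lemma future_directed: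
  assumes x: "mink x x < 0" and p: "mink p p \<le> 0" "p$4 > 0" and xp: "mink x p < 0"
  shows "x$4 > 0"
proof (rule ccontr)
  let ?X = "(x$1)\<^sup>2 + (x$2)\<^sup>2 + (x$3)\<^sup>2" and ?P = "(p$1)\<^sup>2 + (p$2)\<^sup>2 + (p$3)\<^sup>2"
  assume "\<not> x$4 > 0"
  have X: "?X \<le> (x$4)\<^sup>2" using x by (intro mink_le_imp) simp
  have P: "?P \<le> (p$4)\<^sup>2" using p by (intro mink_le_imp) simp
  have "(x$1 * p$1 + x$2 * p$2 + x$3 * p$3)\<^sup>2 \<le> ?X * ?P"
    by (rule mink_spatial_Cauchy_Schwarz)
  also have "\<dots> \<le> (x$4)\<^sup>2 * (p$4)\<^sup>2"
    by (rule mult_mono[OF X P]) simp_all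
  finally have "\<bar>x$1 * p$1 + x$2 * p$2 + x$3 * p$3\<bar> \<le> \<bar>x$4 * p$4\<bar>"
    by (simp add: abs_le_square_iff power_mult_distrib)
  moreover have "x$4 * p$4 \<le> 0"
    using p(2) \<open>\<not> x$4 > 0\<close> by (simp add: mult_nonpos_nonneg)
  ultimately show False using xp by (simp add: mink_def)
qed

definition gram :: "(4 \<Rightarrow> real^4) \<Rightarrow> real^4^4" where
  "gram v = (\<chi> i j. mink (v i) (v j))"

lemma prod_4: "prod f (UNIV::4 set) = f 1 * f 2 * f 3 * f 4"
  unfolding UNIV_4 by (simp add: ac_simps)

lemma det_gram: "det (gram v) = - (det (\<chi> k. v k))\<^sup>2"
proof -
  let ?V = "(\<chi> k. v k) :: real^4^4"
  let ?J = "(\<chi> i j. if i = j then (if i = 4 then -1 else 1) else 0) :: real^4^4"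
  have "gram v = ?V ** ?J ** transpose ?V"
    by (simp add: vec_eq_iff gram_def matrix_matrix_mult_def mink_def transpose_def sum_4 forall_4)
  moreover have "det ?J = -1"
    by (subst det_diagonal) (simp_all add: prod_4)
  ultimately show ?thesis
    by (simp add: det_mul det_transpose power2_eq_square)
qed

definition dual_basis :: "(4 \<Rightarrow> real^4) \<Rightarrow> (4 \<Rightarrow> real^4) \<Rightarrow> bool" where
  "dual_basis m v \<longleftrightarrow> (\<forall>i j. mink (m i) (v j) = (if i = j then 1 else 0))"

text \<open>
  The dual basis supplies face normals from vertices, and later vertices from face normals.
\<close>

lemma dual_basis_exists:
  assumes "det (\<chi> k. v k) \<noteq> 0"
  obtains m where "dual_basis m v" "det (\<chi> k. m k) \<noteq> 0"
proof -
  let ?V = "(\<chi> k. v k) :: real^4^4"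
  obtain B where B: "?V ** B = mat 1"
    using assms invertible_det_nz[of ?V] unfolding invertible_def by blast
  \<comment> \<open>lowering the indices of the columns of the inverse matrix\<close>
  define m :: "4 \<Rightarrow> real^4" where "m i = (\<chi> c. (if c = 4 then -1 else 1) * B$c$i)" for i
  have "mink (m i) (v j) = (if i = j then 1 else 0)" for i j
  proof -
    have "mink (m i) (v j) = (?V ** B)$j$i"
      by (simp add: mink_def m_def matrix_matrix_mult_def sum_4)
    then show ?thesis by (simp add: B mat_def)
  qed
  then have d: "dual_basis m v" by (simp add: dual_basis_def)
  let ?J = "(\<chi> i j. if i = j then (if i = 4 then -1 else 1) else 0) :: real^4^4"
  let ?M = "(\<chi> k. m k) :: real^4^4"
  have "?M ** ?J ** transpose ?V = mat 1"
    using d by (simp add: dual_basis_def vec_eq_iff matrix_matrix_mult_def mink_def transpose_def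
        sum_4 mat_def forall_4)
  then have "det (?M ** ?J ** transpose ?V) = 1" by simp
  then have "det ?M \<noteq> 0" by (auto simp: det_mul)
  with d show ?thesis by (rule that)
qed

lemma basis_expansion:
  assumes "det (\<chi> k. v k) \<noteq> 0" "dual_basis m v"
  shows "x = (\<Sum>k\<in>UNIV. mink (m k) x *\<^sub>R v k)"
proof -
  let ?V = "(\<chi> k. v k) :: real^4^4"
  obtain B where B: "B ** ?V = mat 1"
    using assms invertible_det_nz[of ?V] unfolding invertible_def by blast
  define c where "c = x v* B"
  have "x = c v* ?V" by (simp add: c_def vector_matrix_mul_assoc B)
  then have x: "x = (\<Sum>k\<in>UNIV. c$k *\<^sub>R v k)"
    by (simp add: vec_eq_iff vector_matrix_mult_def sum_component mult.commute)
  have "mink (m k) x = c$k" for k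
  proof -
    have "mink (m k) x = (\<Sum>j\<in>UNIV. c$j * (if k = j then 1 else 0))"
      using assms(2) unfolding dual_basis_def by (subst x) (simp add: mink_sum_right)
    then show ?thesis by (simp add: if_distrib cong: if_cong)
  qed
  then show ?thesis using x by simp
qed

text \<open>
  This is why the inverse of the Gram matrix of the faces describes the vertices.
\<close>

lemma gram_dual:
  assumes "det (\<chi> k. v k) \<noteq> 0" "dual_basis m v"
  shows "gram m ** gram v = mat 1"
proof -
  have "(\<Sum>k\<in>UNIV. mink (m i) (m k) * mink (v k) (v j)) = (if i = j then 1 else 0)" for i j
  proof -
    have "(\<Sum>k\<in>UNIV. mink (m i) (m k) * mink (v k) (v j))
        = mink (\<Sum>k\<in>UNIV. mink (m k) (m i) *\<^sub>R v k) (v j)"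
      unfolding mink_sum_left mink_linear by (intro sum.cong refl) (metis mink_commute)
    also have "\<dots> = mink (m i) (v j)" using basis_expansion[OF assms, of "m i"] by simp
    finally show ?thesis using assms(2) by (simp add: dual_basis_def)
  qed
  then show ?thesis
    by (simp add: vec_eq_iff matrix_matrix_mult_def gram_def mat_def)
qed

lemma ex_4: "(\<exists>i::4. P i) \<longleftrightarrow> P 1 \<or> P 2 \<or> P 3 \<or> P 4"
  by (metis exhaust_4)

lemma ex_distinct_edge:
  fixes i j :: 4
  assumes "i \<noteq> j"
  obtains k l where "{i, j, k, l} = UNIV" "distinct [i, j, k, l]"
proof -
  have "\<exists>k l. {i, j, k, l} = UNIV \<and> distinct [i, j, k, l]"
  proof -
    have "\<forall>i j :: 4. i \<noteq> j \<longrightarrow> (\<exists>k l. {i, j, k, l} = UNIV \<and> distinct [i, j, k, l])"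
      unfolding UNIV_4 by (simp only: forall_4) (simp add: ex_4 insert_commute)
    then show ?thesis using assms by blast
  qed
  then show ?thesis using that by blast
qed

section \<open>Lengths of truncated edges\<close>

text \<open>
  The length of an edge in terms of the product \<open>w\<close> of the two vertices and the product \<open>p\<close> of their
  squares, uniformly for all combinations of proper and ultra-ideal ends.
\<close>

definition arc_len :: "real \<Rightarrow> real \<Rightarrow> real" where
  "arc_len w p = ln ((sqrt (w\<^sup>2 - p) - w) / sqrt \<bar>p\<bar>)"

lemma arc_len_scale:
  assumes "c > 0"
  shows "arc_len (c * w) (c\<^sup>2 * p) = arc_len w p"
proof -
  have "(c * w)\<^sup>2 - c\<^sup>2 * p = c\<^sup>2 * (w\<^sup>2 - p)"
    by (simp add: power_mult_distrib right_diff_distrib)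
  then have "sqrt ((c * w)\<^sup>2 - c\<^sup>2 * p) = c * sqrt (w\<^sup>2 - p)"
    using assms by (metis real_sqrt_mult real_sqrt_abs abs_of_pos)
  then have "sqrt ((c * w)\<^sup>2 - c\<^sup>2 * p) - c * w = c * (sqrt (w\<^sup>2 - p) - w)"
    by (simp add: right_diff_distrib)
  moreover have "sqrt \<bar>c\<^sup>2 * p\<bar> = c * sqrt \<bar>p\<bar>"
    using assms by (simp add: abs_mult real_sqrt_mult)
  ultimately show ?thesis using assms by (simp add: arc_len_def)
qed

text \<open>
  The two factors \<open>sqrt (w\<^sup>2 - p) - w\<close> and \<open>- sqrt (w\<^sup>2 - p) - w\<close> have the product \<open>p\<close>. Half the
  sum and half the difference of these two exponentials are \<open>sigma'\<close> and \<open>sigma\<close>.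
\<close>

lemma exp_arc_len:
  assumes "w < 0" "p \<noteq> 0" "w\<^sup>2 > p"
  shows "exp (arc_len w p) = (sqrt (w\<^sup>2 - p) - w) / sqrt \<bar>p\<bar>"
    and "sgn p * exp (- arc_len w p) = (- sqrt (w\<^sup>2 - p) - w) / sqrt \<bar>p\<bar>"
proof -
  let ?R = "sqrt (w\<^sup>2 - p)"
  have R: "?R > 0" "?R\<^sup>2 = w\<^sup>2 - p" using assms by auto
  have "sqrt \<bar>p\<bar> > 0" using assms by simp
  then have pos: "(?R - w) / sqrt \<bar>p\<bar> > 0"
    using R(1) assms by (intro divide_pos_pos) linarith+
  then show 1: "exp (arc_len w p) = (?R - w) / sqrt \<bar>p\<bar>"
    by (simp add: arc_len_def)
  have "(?R - w) * (- ?R - w) = p" using R(2) by algebra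
  also have "\<dots> = sgn p * (sqrt \<bar>p\<bar>)\<^sup>2" by (simp add: mult_sgn_abs)
  finally have "(?R - w) * (- ?R - w) = sgn p * (sqrt \<bar>p\<bar>)\<^sup>2" .
  then have "sgn p * sqrt \<bar>p\<bar> / (?R - w) = (- ?R - w) / sqrt \<bar>p\<bar>"
    using pos assms R by (simp add: field_simps power2_eq_square)
  then show "sgn p * exp (- arc_len w p) = (- ?R - w) / sqrt \<bar>p\<bar>"
    by (simp add: exp_minus 1)
qed

text \<open>
  The case \<open>p > 0\<close> is that of two proper or two ultra-ideal ends, the case \<open>p < 0\<close> that of a mixed edge.
\<close>

lemma arc_len_eq_arcosh:
  assumes "w < 0" "w\<^sup>2 > p"
  shows "p > 0 \<Longrightarrow> arc_len w p = arcosh (- w / sqrt p)"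
    and "p < 0 \<Longrightarrow> arc_len w p = arcosh (sqrt (w\<^sup>2 - p) / sqrt (- p))"
proof -
  assume p: "p > 0"
  have "- w / sqrt p \<ge> 1"
    using assms p real_sqrt_le_mono[of p "w\<^sup>2"] by (simp add: field_simps)
  moreover have "(- w / sqrt p)\<^sup>2 - 1 = (w\<^sup>2 - p) / p"
    using p by (simp add: power_divide diff_divide_distrib)
  then have "sqrt ((- w / sqrt p)\<^sup>2 - 1) = sqrt (w\<^sup>2 - p) / sqrt p"
    by (metis real_sqrt_divide)
  ultimately have "arcosh (- w / sqrt p) = ln (- w / sqrt p + sqrt (w\<^sup>2 - p) / sqrt p)"
    by (simp only: arcosh_real_def)
  also have "- w / sqrt p + sqrt (w\<^sup>2 - p) / sqrt p = (sqrt (w\<^sup>2 - p) - w) / sqrt \<bar>p\<bar>"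
    using p by (simp add: diff_divide_distrib)
  finally show "arc_len w p = arcosh (- w / sqrt p)" by (simp add: arc_len_def)
next
  assume p: "p < 0"
  have "sqrt (w\<^sup>2 - p) / sqrt (- p) \<ge> 1" using p by simp
  moreover have "(sqrt (w\<^sup>2 - p) / sqrt (- p))\<^sup>2 - 1 = w\<^sup>2 / (- p)"
  proof -
    have "(sqrt (w\<^sup>2 - p) / sqrt (- p))\<^sup>2 = (w\<^sup>2 - p) / (- p)"
      unfolding power_divide using p assms(2) by simp
    also have "\<dots> - 1 = w\<^sup>2 / (- p)" using p by (simp add: field_simps)
    finally show ?thesis .
  qed
  then have "sqrt ((sqrt (w\<^sup>2 - p) / sqrt (- p))\<^sup>2 - 1) = - w / sqrt (- p)"
    using assms(1) by (simp only: real_sqrt_divide) simp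
  ultimately have "arcosh (sqrt (w\<^sup>2 - p) / sqrt (- p))
      = ln (sqrt (w\<^sup>2 - p) / sqrt (- p) + - w / sqrt (- p))"
    by (simp only: arcosh_real_def)
  also have "sqrt (w\<^sup>2 - p) / sqrt (- p) + - w / sqrt (- p) = (sqrt (w\<^sup>2 - p) - w) / sqrt \<bar>p\<bar>"
    using p by (simp add: diff_divide_distrib)
  finally show "arc_len w p = arcosh (sqrt (w\<^sup>2 - p) / sqrt (- p))" by (simp add: arc_len_def)
qed

lemma hyperbolic_space_mink_le:
  assumes "x \<in> hyperbolic_space" "y \<in> hyperbolic_space"
  shows "mink x y \<le> -1"
proof -
  have x: "mink x x = -1" "x$4 > 0" and y: "mink y y = -1" "y$4 > 0"
    using assms by (auto simp: hyperbolic_space_def)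
  \<comment> \<open>the component of \<open>y\<close> orthogonal to \<open>x\<close>\<close>
  let ?z = "y + mink x y *\<^sub>R x"
  have "mink ?z x = 0" using x by (simp add: mink_commute)
  then have "mink ?z ?z \<ge> 0"
    using spacelike_if_orthogonal_timelike[of x ?z] x by (cases "?z = 0") auto
  moreover have "mink ?z ?z = (mink x y)\<^sup>2 - 1"
    using x y by (simp add: mink_commute[of y x] power2_eq_square algebra_simps)
  ultimately have "\<bar>mink x y\<bar> \<ge> 1"
    using abs_le_square_iff[of 1 "mink x y"] by simp
  moreover have "\<not> mink x y > 0"
    using future_directed[of "-x" y] x y by auto
  ultimately show ?thesis by linarith
qed

lemma normalise_timelike:
  assumes "mink x x < 0" "x$4 > 0"
  shows "(1 / sqrt (- mink x x)) *\<^sub>R x \<in> hyperbolic_space"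
proof -
  define a where "a = sqrt (- mink x x)"
  have "a > 0" "mink x x = - (a * a)" using assms by (simp_all add: a_def)
  then show ?thesis using assms(2) unfolding a_def[symmetric] hyperbolic_space_def by simp
qed

text \<open>
  If \<open>x = s e + t f\<close> lies in hyperbolic space with \<open>s, t \<ge> 0\<close>, then \<open>s + t \<le> 1\<close>, because
  \<open>- mink e f \<ge> 1\<close>. Hence the bilinear form of two such points is at most its value at the endpoints.
\<close>

lemma segment_diameter:
  assumes e: "e \<in> hyperbolic_space" and f: "f \<in> hyperbolic_space"
    and A: "\<And>x. x \<in> A \<longleftrightarrow> x \<in> hyperbolic_space \<and> (\<exists>s t. s \<ge> 0 \<and> t \<ge> 0 \<and> x = s *\<^sub>R e + t *\<^sub>R f)"
  shows "(SUP x\<in>A. SUP y\<in>A. ereal (hyp_dist x y)) = ereal (hyp_dist e f)"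
proof (rule antisym)
  have "hyp_dist x y \<le> hyp_dist e f" if xA: "x \<in> A" and yA: "y \<in> A" for x y
  proof -
    obtain s t where x: "s \<ge> 0" "t \<ge> 0" "x = s *\<^sub>R e + t *\<^sub>R f"
      using xA unfolding A by blast
    have xx: "mink x x = -1" using xA unfolding A hyperbolic_space_def by blast
    obtain s' t' where y: "s' \<ge> 0" "t' \<ge> 0" "y = s' *\<^sub>R e + t' *\<^sub>R f"
      using yA unfolding A by blast
    have yy: "mink y y = -1" using yA unfolding A hyperbolic_space_def by blast
    define c where "c = - mink e f"
    have c: "c \<ge> 1" using hyperbolic_space_mink_le[OF e f] by (simp add: c_def)
    have ef: "mink e e = -1" "mink f f = -1" "mink e f = - c" "mink f e = - c"
      using e f by (auto simp: hyperbolic_space_def c_def mink_commute)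
    have le1: "s + t \<le> 1" if "s \<ge> 0" "t \<ge> 0" "s * s + t * t + 2 * c * s * t = 1" for s t
    proof -
      have "2 * s * t \<le> 2 * c * s * t" using c that by (simp add: mult_right_mono)
      then have "(s + t)\<^sup>2 \<le> 1\<^sup>2" using that by (simp add: power2_eq_square algebra_simps)
      then show ?thesis using that power2_le_imp_le[of "s+t" 1] by simp
    qed
    have st: "s + t \<le> 1" using x xx by (intro le1) (auto simp: ef algebra_simps)
    have st': "s' + t' \<le> 1" using y yy by (intro le1) (auto simp: ef algebra_simps)
    have "- mink x y = s' * (s + c * t) + t' * (t + c * s)"
      by (simp add: x y ef algebra_simps)
    also have "\<dots> \<le> s' * (c * s + c * t) + t' * (c * t + c * s)"
      using c x(1,2) y(1,2) mult_right_mono[of 1 c s] mult_right_mono[of 1 c t]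
      by (intro add_mono mult_left_mono) auto
    also have "\<dots> = c * ((s + t) * (s' + t'))" by (simp add: algebra_simps)
    also have "\<dots> \<le> c * 1"
      using c st st' x(1,2) y(1,2) by (intro mult_left_mono mult_le_one) auto
    finally have "- mink x y \<le> - mink e f" by (simp add: c_def)
    moreover have "- mink x y \<ge> 1"
      using xA yA hyperbolic_space_mink_le[of x y] by (simp add: A)
    ultimately show ?thesis
      unfolding hyp_dist_def using c c_def by (metis arcosh_real_strict_mono less_eq_real_def)
  qed
  then show "(SUP x\<in>A. SUP y\<in>A. ereal (hyp_dist x y)) \<le> ereal (hyp_dist e f)"
    by (intro SUP_least) simp
next
  have "e \<in> A" unfolding A using e by (intro conjI exI[of _ 1] exI[of _ 0]) auto
  moreover have "f \<in> A" unfolding A using f by (intro conjI exI[of _ 0] exI[of _ 1]) auto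
  ultimately show "ereal (hyp_dist e f) \<le> (SUP x\<in>A. SUP y\<in>A. ereal (hyp_dist x y))"
    by (intro SUP_upper2[of e] SUP_upper2[of f]) auto
qed

lemma vertex_sign_eq_iff: "vertex_sign v k = -1 \<longleftrightarrow> mink (v k) (v k) > 0"
  by (simp add: vertex_sign_def sgn_if)

text \<open>
  The truncations at the two vertices off the edge cut nothing from it, since distinct vertices have
  negative products.
\<close>

lemma mem_edge_part_iff:
  assumes "generalised_tetrahedron v" "i \<noteq> j"
  shows "x \<in> edge_part v i j \<longleftrightarrow> x \<in> hyperbolic_space
    \<and> (\<exists>s t. s \<ge> 0 \<and> t \<ge> 0 \<and> x = s *\<^sub>R v i + t *\<^sub>R v j)
    \<and> (mink (v i) (v i) > 0 \<longrightarrow> mink x (v i) \<le> 0) \<and> (mink (v j) (v j) > 0 \<longrightarrow> mink x (v j) \<le> 0)"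
  (is "_ \<longleftrightarrow> ?r")
proof
  assume "x \<in> edge_part v i j"
  then show ?r
    by (auto simp: edge_part_def truncated_tetrahedron_def vertex_sign_eq_iff)
next
  assume r: ?r
  then obtain s t where st: "s \<ge> 0" "t \<ge> 0" "x = s *\<^sub>R v i + t *\<^sub>R v j" by blast
  define c where "c = (\<lambda>k. if k = i then s else if k = j then t else 0)"
  have "(\<Sum>k\<in>UNIV. c k *\<^sub>R v k) = (\<Sum>k\<in>{i, j}. c k *\<^sub>R v k)"
    by (rule sum.mono_neutral_right) (auto simp: c_def)
  then have "x = (\<Sum>k\<in>UNIV. c k *\<^sub>R v k)" using assms(2) st by (simp add: c_def)
  moreover have "\<forall>k. c k \<ge> 0" using st by (simp add: c_def)
  moreover have "mink x (v k) \<le> 0" if "vertex_sign v k = -1" for k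
  proof (cases "k = i \<or> k = j")
    case True
    then show ?thesis using r that by (auto simp: vertex_sign_eq_iff)
  next
    case False
    then have "mink (v i) (v k) < 0" "mink (v j) (v k) < 0"
      using assms(1) by (auto simp: generalised_tetrahedron_def)
    then show ?thesis using st by (simp add: add_nonpos_nonpos mult_nonneg_nonpos)
  qed
  ultimately show "x \<in> edge_part v i j"
    using r by (auto simp: edge_part_def truncated_tetrahedron_def)
qed

lemma mem_edge_partI:
  assumes "generalised_tetrahedron v" "i \<noteq> j" "x \<in> hyperbolic_space"
    and "x = s *\<^sub>R v i + t *\<^sub>R v j" "s \<ge> 0" "t \<ge> 0"
    and "mink (v i) (v i) > 0 \<Longrightarrow> mink x (v i) \<le> 0" "mink (v j) (v j) > 0 \<Longrightarrow> mink x (v j) \<le> 0"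
  shows "x \<in> edge_part v i j"
  unfolding mem_edge_part_iff[OF assms(1,2)] using assms(3-) by blast

lemma edge_part_commute:
  assumes "generalised_tetrahedron v" "i \<noteq> j"
  shows "edge_part v i j = edge_part v j i"
proof -
  have "(\<exists>s t. s \<ge> 0 \<and> t \<ge> 0 \<and> x = s *\<^sub>R v i + t *\<^sub>R v j)
    \<longleftrightarrow> (\<exists>s t. s \<ge> 0 \<and> t \<ge> 0 \<and> x = s *\<^sub>R v j + t *\<^sub>R v i)" for x
    by (metis add.commute)
  then show ?thesis using assms by (auto simp: set_eq_iff mem_edge_part_iff)
qed

lemma edge_length_commute:
  assumes "generalised_tetrahedron v" "i \<noteq> j"
  shows "edge_length v i j = edge_length v j i"
  using edge_part_commute[OF assms] by (simp add: edge_length_def)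

text \<open>
  For endpoints given only up to positive factors.
\<close>

lemma edge_length_between:
  assumes E: "mink E E < 0" "E$4 > 0" and F: "mink F F < 0" "F$4 > 0"
    and A: "\<And>x. x \<in> edge_part v i j \<longleftrightarrow>
      x \<in> hyperbolic_space \<and> (\<exists>s t. s \<ge> 0 \<and> t \<ge> 0 \<and> x = s *\<^sub>R E + t *\<^sub>R F)"
  shows "edge_length v i j = ereal (arcosh (- mink E F / sqrt (mink E E * mink F F)))"
proof -
  define a b where "a = sqrt (- mink E E)" and "b = sqrt (- mink F F)"
  have ab: "a > 0" "b > 0" using E F by (auto simp: a_def b_def)
  have "(\<exists>s t. s \<ge> 0 \<and> t \<ge> 0 \<and> x = s *\<^sub>R E + t *\<^sub>R F) \<longleftrightarrow>
        (\<exists>s t. s \<ge> 0 \<and> t \<ge> 0 \<and> x = s *\<^sub>R ((1/a) *\<^sub>R E) + t *\<^sub>R ((1/b) *\<^sub>R F))" for x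
  proof safe
    fix s t :: real assume "s \<ge> 0" "t \<ge> 0"
    then show "\<exists>s' t'. s' \<ge> 0 \<and> t' \<ge> 0 \<and> s *\<^sub>R E + t *\<^sub>R F = s' *\<^sub>R ((1/a) *\<^sub>R E) + t' *\<^sub>R ((1/b) *\<^sub>R F)"
      using ab by (intro exI[of _ "s * a"] exI[of _ "t * b"]) simp
  next
    fix s t :: real assume "s \<ge> 0" "t \<ge> 0"
    then show "\<exists>s' t'. s' \<ge> 0 \<and> t' \<ge> 0 \<and> s *\<^sub>R ((1/a) *\<^sub>R E) + t *\<^sub>R ((1/b) *\<^sub>R F) = s' *\<^sub>R E + t' *\<^sub>R F"
      using ab by (intro exI[of _ "s / a"] exI[of _ "t / b"]) simp
  qed
  with A have "\<And>x. x \<in> edge_part v i j \<longleftrightarrow> x \<in> hyperbolic_space \<and>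
      (\<exists>s t. s \<ge> 0 \<and> t \<ge> 0 \<and> x = s *\<^sub>R ((1/a) *\<^sub>R E) + t *\<^sub>R ((1/b) *\<^sub>R F))" by simp
  from segment_diameter[OF _ _ this]
  have "edge_length v i j = ereal (hyp_dist ((1/a) *\<^sub>R E) ((1/b) *\<^sub>R F))"
    using normalise_timelike[OF E] normalise_timelike[OF F]
    by (simp add: edge_length_def a_def b_def)
  also have "hyp_dist ((1/a) *\<^sub>R E) ((1/b) *\<^sub>R F) = arcosh (- mink E F / sqrt (mink E E * mink F F))"
    by (simp add: hyp_dist_def a_def b_def real_sqrt_mult[symmetric] mult.commute)
  finally show ?thesis .
qed

text \<open>
  An ultra-ideal end \<open>v j\<close> is replaced by \<open>v i - (w / q) v j\<close>, a multiple of the foot of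
  the perpendicular on its polar plane. The truncation condition at this end says exactly that the coefficients with
  respect to the new pair of endpoints are nonnegative, so that the truncated edge is the segment
  between them. When both ends are ultra-ideal the two feet need not point to the future, and the
  nonemptiness of the edge excludes this.
\<close>

lemma edge_length_eq:
  assumes gen: "generalised_tetrahedron v" and ij: "i \<noteq> j"
    and pq: "mink (v i) (v i) \<noteq> 0" "mink (v j) (v j) \<noteq> 0"
    and R: "(mink (v i) (v j))\<^sup>2 > mink (v i) (v i) * mink (v j) (v j)"
    and ne: "edge_part v i j \<noteq> {}"
  shows "edge_length v i j
    = ereal (arc_len (mink (v i) (v j)) (mink (v i) (v i) * mink (v j) (v j)))"
proof -
  have future: "v k $ 4 > 0" if "mink (v k) (v k) < 0" for k
    using gen that by (auto simp: generalised_tetrahedron_def vertex_sign_eq_iff)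
  have mixed: "edge_length v i j
      = ereal (arc_len (mink (v i) (v j)) (mink (v i) (v i) * mink (v j) (v j)))"
    if ij: "i \<noteq> j" and p: "mink (v i) (v i) < 0" and q: "mink (v j) (v j) > 0" for i j
  proof -
    define p q w where "p = mink (v i) (v i)" and "q = mink (v j) (v j)" and "w = mink (v i) (v j)"
    have sgn: "p < 0" "q > 0" "w < 0" "mink (v j) (v i) = w"
      using p q gen ij by (auto simp: p_def q_def w_def generalised_tetrahedron_def mink_commute)
    note abbr = p_def[symmetric] q_def[symmetric] w_def[symmetric] sgn(4)
    \<comment> \<open>a positive multiple of the foot of the perpendicular from \<open>v i\<close> on the polar plane of \<open>v j\<close>\<close>
    define F where "F = v i - (w / q) *\<^sub>R v j"
    have FF: "mink F F = p - w\<^sup>2 / q" and EF: "mink (v i) F = p - w\<^sup>2 / q" and FE: "mink F (v i) = p - w\<^sup>2 / q"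
      and Fj: "mink F (v j) = 0"
      using sgn by (simp_all add: F_def abbr power2_eq_square field_simps)
    have neg: "p - w\<^sup>2 / q < 0" using sgn by (smt (verit) divide_nonneg_pos zero_le_power2)
    have F4: "F$4 > 0"
      using neg p future[OF p] by (intro future_directed[of F "v i"]) (auto simp: FF FE)
    have "edge_length v i j = ereal (arcosh (- mink (v i) F / sqrt (mink (v i) (v i) * mink F F)))"
    proof (rule edge_length_between[OF p future[OF p] _ F4])
      show "mink F F < 0" using FF neg by simp
      fix x
      show "x \<in> edge_part v i j \<longleftrightarrow> x \<in> hyperbolic_space
        \<and> (\<exists>s t. s \<ge> 0 \<and> t \<ge> 0 \<and> x = s *\<^sub>R v i + t *\<^sub>R F)"
      proof (intro iffI conjI; (elim conjE exE)?)
        assume "x \<in> edge_part v i j"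
        then obtain s t where st: "x \<in> hyperbolic_space" "s \<ge> 0" "t \<ge> 0" "x = s *\<^sub>R v i + t *\<^sub>R v j"
          "mink x (v j) \<le> 0" using gen ij q by (auto simp: mem_edge_part_iff)
        then have "s * w + t * q \<le> 0" by (simp add: abbr)
        then have "s + t * q / w \<ge> 0" using sgn by (simp add: field_simps)
        moreover have "- t * q / w \<ge> 0" using sgn st by (simp add: divide_nonneg_neg)
        moreover have "x = (s + t * q / w) *\<^sub>R v i + (- t * q / w) *\<^sub>R F"
        proof -
          have "(- t * q / w) *\<^sub>R F = (- t * q / w) *\<^sub>R v i + t *\<^sub>R v j"
            using sgn by (simp add: F_def scaleR_diff_right)
          then show ?thesis by (simp add: st scaleR_add_left)
        qed
        ultimately show "\<exists>s t. s \<ge> 0 \<and> t \<ge> 0 \<and> x = s *\<^sub>R v i + t *\<^sub>R F" by blast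
      next
        fix s t assume st: "x \<in> hyperbolic_space" "s \<ge> 0" "t \<ge> 0" "x = s *\<^sub>R v i + t *\<^sub>R F"
        have "x = (s + t) *\<^sub>R v i + (- t * w / q) *\<^sub>R v j"
          by (simp add: st F_def scaleR_add_left scaleR_diff_right)
        moreover have "- t * w / q \<ge> 0" "s + t \<ge> 0"
          using st(2,3) sgn(2,3) by (simp_all add: divide_nonpos_pos mult_nonneg_nonpos)
        moreover have "mink x (v j) \<le> 0" using st sgn Fj by (simp add: abbr mult_nonneg_nonpos)
        ultimately show "x \<in> edge_part v i j"
          using p by - (rule mem_edge_partI[OF gen ij st(1)]; (assumption | simp))
      qed (use gen ij in \<open>auto simp: mem_edge_part_iff\<close>)
    qed
    also have "- mink (v i) F / sqrt (mink (v i) (v i) * mink F F) = sqrt (w\<^sup>2 - p * q) / sqrt (- (p * q))"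
    proof -
      have r: "w\<^sup>2 / q - p = (w\<^sup>2 - p * q) / q" using sgn by (simp add: field_simps)
      have pos: "w\<^sup>2 - p * q > 0" using sgn by (smt (verit) mult_neg_pos zero_le_power2)
      have "mink F F = - ((w\<^sup>2 - p * q) / q)" using r FF by simp
      then have "mink (v i) (v i) * mink F F = - p * ((w\<^sup>2 - p * q) / q)"
        by (simp add: abbr)
      then have "- mink (v i) F / sqrt (mink (v i) (v i) * mink F F)
          = ((w\<^sup>2 - p * q) / q) / (sqrt (- p) * (sqrt (w\<^sup>2 - p * q) / sqrt q))"
        using r EF by (simp only: real_sqrt_mult real_sqrt_divide) simp
      also have "\<dots> = sqrt (w\<^sup>2 - p * q) / (sqrt (- p) * sqrt q)"
      proof -
        have "X / Q / (A * (r / u)) = r / (A * u)"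
          if "r > 0" "u > 0" "A > 0" "X = r * r" "Q = u * u" for X Q A r u :: real
          using that by simp
        from this[of "sqrt (w\<^sup>2 - p * q)" "sqrt q" "sqrt (- p)"] show ?thesis
          using pos sgn by simp
      qed
      finally show ?thesis by (simp flip: real_sqrt_mult)
    qed
    also have "arcosh \<dots> = arc_len w (p * q)"
      using sgn arc_len_eq_arcosh(2)[of w "p * q"]
      by (smt (verit) mult_neg_pos zero_le_power2)
    finally show ?thesis by (simp add: abbr)
  qed
  define p q w where "p = mink (v i) (v i)" and "q = mink (v j) (v j)" and "w = mink (v i) (v j)"
  have w: "w < 0" "mink (v j) (v i) = w"
    using gen ij by (auto simp: w_def generalised_tetrahedron_def mink_commute)
  note abbr = p_def[symmetric] q_def[symmetric] w_def[symmetric] w(2)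
  have R': "w\<^sup>2 > p * q" using R by (simp add: abbr)
  consider "p < 0" "q < 0" | "p < 0" "q > 0" | "p > 0" "q < 0" | "p > 0" "q > 0"
    using pq unfolding abbr by linarith
  then show ?thesis
  proof cases
    case 1
    then have "edge_length v i j = ereal (arcosh (- mink (v i) (v j) / sqrt (mink (v i) (v i) * mink (v j) (v j))))"
      using gen ij by (intro edge_length_between future) (auto simp: mem_edge_part_iff abbr)
    then show ?thesis
      using 1 arc_len_eq_arcosh(1)[OF w(1) R'] by (simp add: abbr mult_neg_neg)
  next
    case 2
    then show ?thesis using mixed[OF ij] by (simp add: abbr)
  next
    case 3
    then show ?thesis using mixed[of j i] ij edge_length_commute[OF gen ij]
      by (simp add: abbr mult.commute)
  next
    case 4
    define a b where "a = - w / p" and "b = - w / q"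
    have ab: "a > 0" "b > 0" "a * b > 1"
      using 4 w(1) R' by (simp_all add: a_def b_def power2_eq_square divide_neg_pos)
    \<comment> \<open>positive multiples of the feet on the polar planes of \<open>v i\<close> and \<open>v j\<close>\<close>
    define E F where "E = v j + a *\<^sub>R v i" and "F = v i + b *\<^sub>R v j"
    have EE: "mink E E = - (w\<^sup>2 - p * q) / p" and FF: "mink F F = - (w\<^sup>2 - p * q) / q"
      and EF: "mink E F = w * (w\<^sup>2 - p * q) / (p * q)" and FE: "mink F E = w * (w\<^sup>2 - p * q) / (p * q)"
      and Ei: "mink E (v i) = 0" and Fj: "mink F (v j) = 0"
      and Ej: "mink E (v j) = - (w\<^sup>2 - p * q) / p" and Fi: "mink F (v i) = - (w\<^sup>2 - p * q) / q"
      using 4 by (simp_all add: E_def F_def abbr a_def b_def field_simps power2_eq_square)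
    have neg: "mink E E < 0" "mink F F < 0" "mink E F < 0" "mink F E < 0"
      using 4 R' w by (auto simp: EE FF EF FE divide_less_0_iff mult_less_0_iff)
    have dec: "\<exists>s t. s \<ge> 0 \<and> t \<ge> 0 \<and> x = s *\<^sub>R E + t *\<^sub>R F" if xe: "x \<in> edge_part v i j" for x
    proof -
      obtain s t where st: "x \<in> hyperbolic_space" "s \<ge> 0" "t \<ge> 0" "x = s *\<^sub>R v i + t *\<^sub>R v j"
        "mink x (v i) \<le> 0" "mink x (v j) \<le> 0"
        using xe gen ij 4 by (auto simp: mem_edge_part_iff abbr)
      then have "s * p + t * w \<le> 0" "s * w + t * q \<le> 0" by (simp_all add: abbr)
      then have "s \<le> - (t * w) / p" "t \<le> - (s * w) / q"
        using 4 by (simp_all only: pos_le_divide_eq)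
      then have nn: "(t * a - s) / (a * b - 1) \<ge> 0" "(s * b - t) / (a * b - 1) \<ge> 0"
        using ab(3) by (simp_all add: a_def b_def)
      have "(s * b - t) *\<^sub>R E + (t * a - s) *\<^sub>R F = (a * b - 1) *\<^sub>R x"
        by (simp add: st E_def F_def algebra_simps)
      then have "x = (1 / (a * b - 1)) *\<^sub>R ((s * b - t) *\<^sub>R E + (t * a - s) *\<^sub>R F)"
        using ab by simp
      then have "x = ((s * b - t) / (a * b - 1)) *\<^sub>R E + ((t * a - s) / (a * b - 1)) *\<^sub>R F"
        by (simp add: scaleR_add_right)
      then show ?thesis using nn by blast
    qed
    obtain x where x: "x \<in> edge_part v i j" using ne by blast
    then obtain c d where cd: "c \<ge> 0" "d \<ge> 0" "x = c *\<^sub>R E + d *\<^sub>R F" using dec by blast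
    have xH: "mink x x = -1" "x$4 > 0" using x gen ij by (auto simp: mem_edge_part_iff hyperbolic_space_def)
    have "c > 0 \<or> d > 0" using cd xH by (cases "c = 0"; cases "d = 0") auto
    then have "mink E x < 0" "mink F x < 0"
      using cd neg by (auto simp: add_neg_nonpos add_nonpos_neg mult_pos_neg mult_nonneg_nonpos)
    then have E4: "E$4 > 0" and F4: "F$4 > 0"
      using future_directed[of E x] future_directed[of F x] neg xH by auto
    have "edge_length v i j = ereal (arcosh (- mink E F / sqrt (mink E E * mink F F)))"
    proof (rule edge_length_between[OF neg(1) E4 neg(2) F4])
      fix x
      show "x \<in> edge_part v i j \<longleftrightarrow> x \<in> hyperbolic_space
        \<and> (\<exists>s t. s \<ge> 0 \<and> t \<ge> 0 \<and> x = s *\<^sub>R E + t *\<^sub>R F)"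
      proof (intro iffI conjI; (elim conjE exE)?)
        fix s t assume st: "x \<in> hyperbolic_space" "s \<ge> 0" "t \<ge> 0" "x = s *\<^sub>R E + t *\<^sub>R F"
        have "x = (s * a + t) *\<^sub>R v i + (s + t * b) *\<^sub>R v j"
          by (simp add: st E_def F_def algebra_simps)
        moreover have "s * a + t \<ge> 0" "s + t * b \<ge> 0" using st ab by simp_all
        moreover have "mink x (v i) \<le> 0" "mink x (v j) \<le> 0"
          using st Ei Fj neg Ej[folded EE] Fi[folded FF] by (simp_all add: mult_nonneg_nonpos)
        ultimately show "x \<in> edge_part v i j"
          by - (rule mem_edge_partI[OF gen ij st(1)]; assumption)
      qed (use gen ij dec in \<open>auto simp: mem_edge_part_iff\<close>)
    qed
    also have "- mink E F / sqrt (mink E E * mink F F) = - w / sqrt (p * q)"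
    proof -
      have "mink E E * mink F F = (w\<^sup>2 - p * q)\<^sup>2 / (p * q)"
        by (simp add: EE FF power2_eq_square) algebra
      then have "sqrt (mink E E * mink F F) = (w\<^sup>2 - p * q) / sqrt (p * q)"
        using R' by (simp add: real_sqrt_divide)
      moreover have "- (w * X / Q) / (X / r) = - w / r" if "X > 0" "r > 0" "Q = r * r" for X Q r :: real
        using that by simp
      from this[of "w\<^sup>2 - p * q" "sqrt (p * q)" "p * q"]
      have "- (w * (w\<^sup>2 - p * q) / (p * q)) / ((w\<^sup>2 - p * q) / sqrt (p * q)) = - w / sqrt (p * q)"
        using R' 4 by (simp del: real_sqrt_mult_self add: real_sqrt_mult_self[of "p * q"] abs_mult)
      ultimately show ?thesis by (simp only: EF)
    qed
    also have "arcosh \<dots> = arc_len w (p * q)"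
      using arc_len_eq_arcosh(1)[OF w(1) R'] 4 by simp
    finally show ?thesis by (simp add: abbr)
  qed
qed

text \<open>
  The points \<open>s v i + t v j\<close> of hyperbolic space form a ray that is parametrised by \<open>t\<close>, and the
  distance of the points for \<open>t\<close> and \<open>t'\<close> is \<open>ln (t / t')\<close>. It is unbounded as \<open>t'\<close> tends to \<open>0\<close>.
\<close>

lemma edge_length_ideal:
  assumes gen: "generalised_tetrahedron v" and ij: "i \<noteq> j" and i0: "mink (v i) (v i) = 0"
  shows "edge_length v i j = \<infinity>"
proof -
  define q w where "q = mink (v j) (v j)" and "w = mink (v i) (v j)"
  have w: "w < 0" "mink (v j) (v i) = w"
    using gen ij by (auto simp: w_def generalised_tetrahedron_def mink_commute)
  note abbr = q_def[symmetric] w_def[symmetric] w(2)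
  have vi: "v i $ 4 > 0"
    using gen i0 by (auto simp: generalised_tetrahedron_def vertex_sign_eq_iff)
  define x where "x t = (- (1 + q * t\<^sup>2) / (2 * w * t)) *\<^sub>R v i + t *\<^sub>R v j" for t
  have prod: "mink (x t) (x t') = - (t / t' + t' / t) / 2" if "t > 0" "t' > 0" for t t'
    using that w i0 by (simp add: x_def abbr field_simps power2_eq_square)
  have mem: "x t \<in> edge_part v i j" if t: "t > 0" "\<bar>q\<bar> * t\<^sup>2 \<le> 1" for t
  proof -
    have xx: "mink (x t) (x t) = -1" using prod[of t t] t by simp
    have xi: "mink (x t) (v i) < 0" using t w i0 by (simp add: x_def abbr mult_pos_neg)
    have "x t $ 4 > 0" using xx xi vi i0 by (intro future_directed[of "x t" "v i"]) auto
    then have H: "x t \<in> hyperbolic_space" using xx by (simp add: hyperbolic_space_def)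
    have q: "1 + q * t\<^sup>2 \<ge> 0" "q * t\<^sup>2 \<le> 1"
      using t(2) abs_le_iff[of "q * t\<^sup>2" 1] by (simp_all add: abs_mult)
    have "2 * w * t < 0" using w t by (simp add: mult_neg_pos)
    then have s: "- (1 + q * t\<^sup>2) / (2 * w * t) \<ge> 0" using q by (intro divide_nonpos_neg) auto
    have "mink (x t) (v j) = (q * t\<^sup>2 - 1) / (2 * t)"
      using t w by (simp add: x_def abbr field_simps power2_eq_square)
    also have "\<dots> \<le> 0" using q t by (intro divide_nonpos_pos) auto
    finally have xj: "mink (x t) (v j) \<le> 0" .
    show ?thesis
      using s xj xi t(1) by (intro mem_edge_partI[OF gen ij H x_def]) auto
  qed
  \<comment> \<open>small enough for the truncation at the other end\<close>
  define t0 where "t0 = 1 / sqrt (1 + \<bar>q\<bar>)"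
  have t0: "t0 > 0" "\<bar>q\<bar> * t0\<^sup>2 \<le> 1"
    by (auto simp: t0_def power_divide add_pos_nonneg)
  have ge: "ereal r \<le> edge_length v i j" if r: "r \<ge> 0" for r
  proof -
    let ?t = "t0 * exp (- r)"
    have "?t \<le> t0" using r t0 by simp
    then have "\<bar>q\<bar> * ?t\<^sup>2 \<le> \<bar>q\<bar> * t0\<^sup>2"
      using t0 by (intro mult_left_mono power_mono) auto
    then have "x ?t \<in> edge_part v i j" using t0 by (intro mem) auto
    moreover have "x t0 \<in> edge_part v i j" using t0 by (intro mem)
    moreover have "hyp_dist (x t0) (x ?t) = r"
    proof -
      have "- mink (x t0) (x ?t) = cosh r"
        using t0 prod[of t0 ?t] by (simp add: cosh_def exp_minus field_simps)
      then show ?thesis using r by (simp add: hyp_dist_def arcosh_cosh_real)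
    qed
    ultimately show ?thesis
      unfolding edge_length_def by (intro SUP_upper2[of "x t0"] SUP_upper2[of "x ?t"]) auto
  qed
  show ?thesis
  proof (cases "edge_length v i j")
    case (real r)
    then show ?thesis using ge[of "\<bar>r\<bar> + 1"] by simp
  next
    case MInf
    then show ?thesis using ge[of 0] by simp
  qed
qed

section \<open>Minors of matrices of order four\<close>

lemma det_4:
  "det (A :: real^4^4) =
    A$1$1 * (A$2$2 * (A$3$3 * A$4$4 - A$3$4 * A$4$3) - A$2$3 * (A$3$2 * A$4$4 - A$3$4 * A$4$2)
      + A$2$4 * (A$3$2 * A$4$3 - A$3$3 * A$4$2))
  - A$1$2 * (A$2$1 * (A$3$3 * A$4$4 - A$3$4 * A$4$3) - A$2$3 * (A$3$1 * A$4$4 - A$3$4 * A$4$1)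
      + A$2$4 * (A$3$1 * A$4$3 - A$3$3 * A$4$1))
  + A$1$3 * (A$2$1 * (A$3$2 * A$4$4 - A$3$4 * A$4$2) - A$2$2 * (A$3$1 * A$4$4 - A$3$4 * A$4$1)
      + A$2$4 * (A$3$1 * A$4$2 - A$3$2 * A$4$1))
  - A$1$4 * (A$2$1 * (A$3$2 * A$4$3 - A$3$3 * A$4$2) - A$2$2 * (A$3$1 * A$4$3 - A$3$3 * A$4$1)
      + A$2$3 * (A$3$1 * A$4$2 - A$3$2 * A$4$1))"
proof -
  have 1: "finite {2::4, 3, 4}" "1 \<notin> {2::4, 3, 4}" and 2: "finite {3::4, 4}" "2 \<notin> {3::4, 4}"
    and 3: "finite {4::4}" "3 \<notin> {4::4}"
    by auto
  show ?thesis
    unfolding det_def UNIV_4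
    unfolding sum_over_permutations_insert[OF 1]
    unfolding sum_over_permutations_insert[OF 2]
    unfolding sum_over_permutations_insert[OF 3]
    unfolding permutes_sing
    by (simp add: sign_swap_id permutation_swap_id sign_compose sign_id swap_id_eq permutation_compose)
      (simp add: algebra_simps)
qed

lemma exhaust_6: "x = 1 \<or> x = 2 \<or> x = 3 \<or> x = 4 \<or> x = 5 \<or> x = 6" for x :: 6
proof (induct x)
  case (of_int z)
  then have "z = 0 \<or> z = 1 \<or> z = 2 \<or> z = 3 \<or> z = 4 \<or> z = 5" by fastforce
  then show ?case by auto
qed

lemma forall_6: "(\<forall>i::6. P i) \<longleftrightarrow> P 1 \<and> P 2 \<and> P 3 \<and> P 4 \<and> P 5 \<and> P 6"
  by (metis exhaust_6)

lemma vector_4 [simp]: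
  "(vector [a, b, c, d] :: 'a::zero^4)$1 = a" "(vector [a, b, c, d] :: 'a^4)$2 = b"
  "(vector [a, b, c, d] :: 'a^4)$3 = c" "(vector [a, b, c, d] :: 'a^4)$4 = d"
  by (simp_all add: vector_def)

lemma vector_6 [simp]:
  "(vector [a, b, c, d, e, f] :: 'a::zero^6)$1 = a" "(vector [a, b, c, d, e, f] :: 'a^6)$2 = b"
  "(vector [a, b, c, d, e, f] :: 'a^6)$3 = c" "(vector [a, b, c, d, e, f] :: 'a^6)$4 = d"
  "(vector [a, b, c, d, e, f] :: 'a^6)$5 = e" "(vector [a, b, c, d, e, f] :: 'a^6)$6 = f"
  by (simp_all add: vector_def)

text \<open>
  Multiplying \<open>A\<close> by the identity matrix with column \<open>i\<close> replaced by that of \<open>H\<close> replaces the same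
  column of \<open>A\<close> by a unit vector.
\<close>

lemma det_principal_submatrix:
  fixes A H :: "real^4^4"
  assumes "A ** H = mat 1"
  shows "det (principal_submatrix A i) = det A * H$i$i"
proof -
  define B :: "real^4^4" where "B = (\<chi> r c. if c = i then H$r$i else if r = c then 1 else 0)"
  define C :: "real^4^4" where "C = (\<chi> r c. if c = i then (if r = i then 1 else 0) else A$r$c)"
  have H: "(\<Sum>k\<in>UNIV. A$r$k * H$k$c) = (if r = c then 1 else 0)" for r c
    using assms by (simp add: vec_eq_iff matrix_matrix_mult_def mat_def)
  have "(A ** B)$r$c = C$r$c" for r c
    by (cases "c = i") (simp_all add: matrix_matrix_mult_def B_def C_def H if_distrib[of "\<lambda>x. _ * x"] cong: if_cong)
  then have "A ** B = C" by (simp add: vec_eq_iff)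
  then have "det A * det B = det C" by (metis det_mul)
  moreover have "\<forall>i. det (\<chi> r c. if c = i then H$r$i else if r = c then 1 else 0) = H$i$i"
    by (simp add: forall_4 det_4)
  then have "det B = H$i$i" by (simp add: B_def)
  moreover have "\<forall>i. det (\<chi> r c. if c = i then (if r = i then 1 else 0) else A$r$c) = det (principal_submatrix A i)"
    by (simp add: forall_4 det_4 det_3 principal_submatrix_def Let_def)
      (simp add: algebra_simps)
  then have "det C = det (principal_submatrix A i)" by (simp add: C_def)
  ultimately show ?thesis by simp
qed

lemma distinct_if_UNIV_4:
  fixes i j k l :: 4
  assumes "{i, j, k, l} = UNIV"
  shows "i \<noteq> j" "i \<noteq> k" "i \<noteq> l" "j \<noteq> k" "j \<noteq> l" "k \<noteq> l"
  using assms card_distinct[of "[i, j, k, l]"] by simp_all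

text \<open>
  Jacobi's identity for complementary minors, by the same trick with two columns.
\<close>

lemma Jacobi_minor:
  fixes i j k l :: 4 and A H :: "real^4^4"
  assumes "A ** H = mat 1" and ij: "{i, j, k, l} = UNIV"
  shows "A$i$i * A$j$j - A$i$j * A$j$i = det A * (H$k$k * H$l$l - H$k$l * H$l$k)"
proof -
  define B :: "real^4^4" where "B = (\<chi> r c. if c = k \<or> c = l then H$r$c else if r = c then 1 else 0)"
  define C :: "real^4^4" where
    "C = (\<chi> r c. if c = k \<or> c = l then (if r = c then 1 else 0) else A$r$c)"
  have H: "(\<Sum>k\<in>UNIV. A$r$k * H$k$c) = (if r = c then 1 else 0)" for r c
    using assms by (simp add: vec_eq_iff matrix_matrix_mult_def mat_def)
  have "(A ** B)$r$c = C$r$c" for r c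
    by (cases "c = k \<or> c = l")
      (simp_all add: matrix_matrix_mult_def B_def C_def H if_distrib[of "\<lambda>x. _ * x"] cong: if_cong)
  then have "A ** B = C" by (simp add: vec_eq_iff)
  then have "det A * det B = det C" by (metis det_mul)
  moreover have "\<forall>k l. k \<noteq> l \<longrightarrow> det (\<chi> r c. if c = k \<or> c = l then H$r$c else if r = c then 1 else 0)
      = H$k$k * H$l$l - H$k$l * H$l$k"
    by (simp add: forall_4 det_4)
  then have "det B = H$k$k * H$l$l - H$k$l * H$l$k"
    using distinct_if_UNIV_4[OF ij] by (simp add: B_def)
  moreover have "\<forall>i j k l :: 4. distinct [i, j, k, l] \<longrightarrow>
    det (\<chi> r c. if c = k \<or> c = l then (if r = c then 1 else 0) else A$r$c) = A$i$i * A$j$j - A$i$j * A$j$i"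
    by (simp add: forall_4 det_4)
  then have "det C = A$i$i * A$j$j - A$i$j * A$j$i"
    using distinct_if_UNIV_4[OF ij] by (simp add: C_def)
  ultimately show ?thesis by simp
qed

section \<open>Dihedral angles and their Gram matrix\<close>

lemma matrix_inv_eqI:
  fixes A B :: "real^'n^'n"
  assumes "A ** B = mat 1"
  shows "matrix_inv A = B"
proof -
  have BA: "B ** A = mat 1" using assms by (simp add: matrix_left_right_inverse)
  then have "A ** matrix_inv A = mat 1 \<and> matrix_inv A ** A = mat 1"
    using assms unfolding matrix_inv_def
    by (intro someI[of "\<lambda>A'. A ** A' = mat 1 \<and> A' ** A = mat 1" B]) simp
  then have "B ** (A ** matrix_inv A) = B" by simp
  then show ?thesis by (simp add: matrix_mul_assoc BA)
qed

lemma matrix_inv_right: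
  fixes A :: "real^'n^'n"
  assumes "det A \<noteq> 0"
  shows "A ** matrix_inv A = mat 1"
proof -
  obtain B where "A ** B = mat 1"
    using assms invertible_det_nz[of A] unfolding invertible_def by blast
  then show ?thesis using matrix_inv_eqI by fastforce
qed

text \<open>
  The position of an edge in \<open>edge_vector\<close>, as a symmetric function of its ends.
\<close>

definition edge_index :: "4 \<Rightarrow> 4 \<Rightarrow> 6" where
  "edge_index i j = (if {i, j} = {1, 2} then 1 else if {i, j} = {1, 3} then 2
    else if {i, j} = {1, 4} then 3 else if {i, j} = {2, 3} then 4
    else if {i, j} = {2, 4} then 5 else 6)"

lemma edge_index_commute: "edge_index i j = edge_index j i"
  by (simp add: edge_index_def insert_commute)

lemma edge_vector_nth:
  assumes "\<And>i j. i \<noteq> j \<Longrightarrow> f i j = f j i" "i \<noteq> j"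
  shows "edge_vector f $ edge_index i j = f i j"
proof -
  have "\<forall>i j. i \<noteq> j \<longrightarrow> edge_vector f $ edge_index i j = f i j"
    using assms(1) by (simp add: forall_4 edge_index_def edge_vector_def doubleton_eq_iff)
  with assms(2) show ?thesis by blast
qed

lemma ex_edge_index: "\<exists>i j. i \<noteq> j \<and> edge_index i j = e"
proof -
  have "\<forall>e. \<exists>i j. i \<noteq> j \<and> edge_index i j = e"
    by (simp add: forall_6 ex_4 edge_index_def doubleton_eq_iff)
  then show ?thesis by blast
qed

lemma opposite_commute: "opposite f i j = opposite f j i"
  by (simp add: opposite_def insert_commute)

text \<open>
  The Gram matrix as a function of an angle vector, defined for vectors that need not come from a
  tetrahedron.
\<close>

definition angle_gram :: "real^6 \<Rightarrow> real^4^4" where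
  "angle_gram \<alpha> = gram_matrix (\<lambda>i j. \<alpha> $ edge_index i j)"

lemma angle_gram_diag: "angle_gram \<alpha> $ i $ i = 1"
  by (simp add: angle_gram_def gram_matrix_def)

lemma angle_gram_nth:
  assumes "{i, j, k, l} = UNIV"
  shows "angle_gram \<alpha> $ i $ j = - cos (\<alpha> $ edge_index k l)"
  using distinct_if_UNIV_4[OF assms] opposite_eq[OF _ assms, of "\<lambda>i j. \<alpha> $ edge_index i j"]
  by (simp add: angle_gram_def gram_matrix_def edge_index_commute)

lemma angle_gram_symmetric: "angle_gram \<alpha> $ i $ j = angle_gram \<alpha> $ j $ i"
  by (simp add: angle_gram_def gram_matrix_def opposite_commute)

lemma gram_matrix_eq_angle_gram:
  assumes "\<And>i j. f i j = f j i"
  shows "gram_matrix f = angle_gram (edge_vector f)"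
proof -
  have "gram_matrix f $ i $ j = angle_gram (edge_vector f) $ i $ j" for i j
  proof (cases "i = j")
    case True
    then show ?thesis by (simp add: angle_gram_diag) (simp add: gram_matrix_def)
  next
    case False
    then obtain k l where kl: "{i, j, k, l} = UNIV" by (rule ex_distinct_edge)
    note d = distinct_if_UNIV_4[OF kl]
    have "gram_matrix f $ i $ j = - cos (f k l)"
      using False opposite_eq[OF assms kl] by (simp add: gram_matrix_def)
    also have "f k l = edge_vector f $ edge_index k l"
      using d assms by (simp add: edge_vector_nth)
    finally show ?thesis by (simp add: angle_gram_nth[OF kl])
  qed
  then show ?thesis by (simp add: vec_eq_iff)
qed

text \<open>
  The conditions on the inverse of the Gram matrix say that no vertex is ideal, and that distinct vertices have negative
  products.
\<close>

definition realisable :: "real^6 \<Rightarrow> bool" where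
  "realisable \<alpha> \<longleftrightarrow> (\<forall>e. 0 < \<alpha>$e \<and> \<alpha>$e < pi) \<and> det (angle_gram \<alpha>) < 0 \<and>
     (\<forall>i. matrix_inv (angle_gram \<alpha>) $ i $ i \<noteq> 0) \<and>
     (\<forall>i j. i \<noteq> j \<longrightarrow> matrix_inv (angle_gram \<alpha>) $ i $ j < 0)"

definition angle_len :: "real^6 \<Rightarrow> 4 \<Rightarrow> 4 \<Rightarrow> real" where
  "angle_len \<alpha> i j = (let H = matrix_inv (angle_gram \<alpha>) in arc_len (H$i$j) (H$i$i * H$j$j))"

lemma matrix_inv_symmetric:
  fixes A :: "real^'n^'n"
  assumes "det A \<noteq> 0" "\<And>i j. A$i$j = A$j$i"
  shows "matrix_inv A $ i $ j = matrix_inv A $ j $ i"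
proof -
  have "transpose (A ** matrix_inv A) = mat 1" using matrix_inv_right[OF assms(1)] by (simp add: transpose_mat)
  then have "transpose (matrix_inv A) ** A = mat 1"
    using assms(2) by (simp add: matrix_transpose_mul transpose_def[of A])
  then have "A ** transpose (matrix_inv A) = mat 1" by (simp add: matrix_left_right_inverse)
  then have "matrix_inv A = transpose (matrix_inv A)" by (rule matrix_inv_eqI)
  then have "matrix_inv A $ i $ j = transpose (matrix_inv A) $ i $ j" by (rule arg_cong)
  then show ?thesis by (simp add: transpose_def)
qed

text \<open>
  A vector orthogonal to the other three vertices is a multiple of the dual vector, and the
  normalisation and the sign leave only one multiple.
\<close>

lemma outward_normal_eq:
  assumes "det (\<chi> k. v k) \<noteq> 0"
    and n: "mink n n = 1" "\<And>j. j \<noteq> k \<Longrightarrow> mink n (v j) = 0" "mink n (v k) < 0"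
  shows "outward_normal v k = n"
  unfolding outward_normal_def
proof (rule the_equality)
  show "mink n n = 1 \<and> (\<forall>j. j \<noteq> k \<longrightarrow> mink n (v j) = 0) \<and> mink n (v k) < 0"
    using n by blast
next
  fix u assume u: "mink u u = 1 \<and> (\<forall>j. j \<noteq> k \<longrightarrow> mink u (v j) = 0) \<and> mink u (v k) < 0"
  obtain m where m: "dual_basis m v" "det (\<chi> k. m k) \<noteq> 0"
    using dual_basis_exists[OF assms(1)] .
  have vm: "dual_basis v m" using m(1) by (simp add: dual_basis_def mink_commute[of "v _"])
  have span: "x = mink x (v k) *\<^sub>R m k" if x: "\<And>j. j \<noteq> k \<Longrightarrow> mink x (v j) = 0" for x
  proof -
    have "x = (\<Sum>j\<in>UNIV. mink (v j) x *\<^sub>R m j)" by (rule basis_expansion[OF m(2) vm])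
    also have "\<dots> = (\<Sum>j\<in>{k}. mink (v j) x *\<^sub>R m j)"
      using x by (intro sum.mono_neutral_right) (auto simp: mink_commute[of "v _"])
    finally show ?thesis by (simp add: mink_commute[of x])
  qed
  have un: "u = mink u (v k) *\<^sub>R m k" "n = mink n (v k) *\<^sub>R m k"
    using u n by (auto intro: span)
  have "(mink u (v k))\<^sup>2 * mink (m k) (m k) = 1" "(mink n (v k))\<^sup>2 * mink (m k) (m k) = 1"
    using u n(1) arg_cong2[OF un(1) un(1), of mink] arg_cong2[OF un(2) un(2), of mink]
    by (simp_all add: power2_eq_square)
  then have "(mink u (v k))\<^sup>2 = (mink n (v k))\<^sup>2"
    by (metis mult_cancel_right mult_zero_right zero_neq_one)
  then have "mink u (v k) = mink n (v k)" using u n(3) by (simp add: power2_eq_iff)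
  then show "u = n" using un by simp
qed

lemma dihedral_angle_eq:
  assumes "det (\<chi> k. v k) \<noteq> 0"
    and n: "\<And>k. mink (n k) (n k) = 1" "\<And>k j. j \<noteq> k \<Longrightarrow> mink (n k) (v j) = 0"
      "\<And>k. mink (n k) (v k) < 0"
    and kl: "{i, j, k, l} = UNIV"
  shows "dihedral_angle v i j = arccos (- mink (n k) (n l))"
proof -
  have o: "outward_normal v k = n k" for k
    using assms(1) n by (intro outward_normal_eq)
  show ?thesis unfolding dihedral_angle_def o
    by (rule opposite_eq[OF _ kl]) (simp add: mink_commute)
qed

lemma dihedral_angle_commute: "dihedral_angle v i j = dihedral_angle v j i"
  by (simp add: dihedral_angle_def opposite_commute)

lemma sum_dual_gram:
  assumes "det (\<chi> k. v k) \<noteq> 0" "dual_basis m v"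
  shows "(\<Sum>k\<in>UNIV. mink (m i) (m k) * mink (v k) (v j)) = (if i = j then 1 else 0)"
  using gram_dual[OF assms] by (simp add: vec_eq_iff matrix_matrix_mult_def gram_def mat_def)

text \<open>
  Every edge contains a timelike vector, being nonempty. It makes the normals of the faces through
  the edge spacelike, so that they can be normalised, and makes the angle between them proper. The Gram
  matrix of the normals is inverted by that of the dual basis, whose vectors are positive multiples of
  \<open>- v k\<close>.
\<close>

theorem lengths_from_angles:
  assumes mild: "mildly_truncated v"
    and L: "\<And>i j. i \<noteq> j \<Longrightarrow> edge_length v i j = ereal (L i j)"
  defines "\<alpha> \<equiv> edge_vector (dihedral_angle v)"
  shows "realisable \<alpha>" "gram_matrix (dihedral_angle v) = angle_gram \<alpha>"
    "\<And>i j. i \<noteq> j \<Longrightarrow> L i j = angle_len \<alpha> i j"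
    "\<And>k. vertex_sign v k = - sgn (matrix_inv (angle_gram \<alpha>) $ k $ k)"
proof -
  have gen: "generalised_tetrahedron v" using mild by (simp add: mildly_truncated_def)
  then have det: "det (\<chi> k. v k) \<noteq> 0" and neg: "\<And>i j. i \<noteq> j \<Longrightarrow> mink (v i) (v j) < 0"
    by (auto simp: generalised_tetrahedron_def)
  have nonideal: "mink (v k) (v k) \<noteq> 0" for k
  proof
    assume "mink (v k) (v k) = 0"
    moreover obtain j :: 4 where "k \<noteq> j" by (metis zero_neq_one)
    ultimately show False using edge_length_ideal[OF gen] L by fastforce
  qed
  have nonempty: "edge_part v i j \<noteq> {}" if "i \<noteq> j" for i j
    using L[OF that] by (auto simp: edge_length_def bot_ereal_def)
  have timelike: "\<exists>e. mink e e < 0 \<and> (\<exists>s t. e = s *\<^sub>R v i + t *\<^sub>R v j)" if "i \<noteq> j" for i j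
    using nonempty[OF that] mem_edge_part_iff[OF gen that] by (force simp: hyperbolic_space_def)
  obtain m where m: "dual_basis m v" using dual_basis_exists[OF det] .
  then have mv: "mink (m i) (v j) = (if i = j then 1 else 0)" for i j
    by (simp add: dual_basis_def)
  have mpos: "mink (m k) (m k) > 0" for k
  proof -
    obtain i' where "k \<noteq> i'" by (metis zero_neq_one)
    then obtain i j where kij: "{k, i', i, j} = UNIV" by (rule ex_distinct_edge)
    note d = distinct_if_UNIV_4[OF kij]
    obtain e s t where e: "mink e e < 0" "e = s *\<^sub>R v i + t *\<^sub>R v j"
      using timelike[of i j] d by blast
    have "mink (m k) e = 0" using d by (simp add: e(2) mv)
    moreover have "m k \<noteq> 0" using mv[of k k] by auto
    ultimately show ?thesis using e(1) spacelike_if_orthogonal_timelike by blast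
  qed
  define \<mu> where "\<mu> k = sqrt (mink (m k) (m k))" for k
  have \<mu>: "\<mu> k > 0" "\<mu> k * \<mu> k = mink (m k) (m k)" for k
    using mpos[of k] by (simp_all add: \<mu>_def)
  \<comment> \<open>the outward unit normals\<close>
  define n where "n k = (- (1 / \<mu> k)) *\<^sub>R m k" for k
  have n: "mink (n k) (n k) = 1" "j \<noteq> k \<Longrightarrow> mink (n k) (v j) = 0" "mink (n k) (v k) < 0" for j k
    using \<mu>[of k] mpos[of k] by (simp_all add: n_def mv)
  have nn: "\<bar>mink (n i) (n j)\<bar> < 1" if ij: "i \<noteq> j" for i j
  proof -
    obtain k l where kl: "{i, j, k, l} = UNIV" using ex_distinct_edge[OF ij] .
    note d = distinct_if_UNIV_4[OF kl]
    obtain e s t where e: "mink e e < 0" "e = s *\<^sub>R v k + t *\<^sub>R v l"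
      using timelike[of k l] d by blast
    \<comment> \<open>the projection of \<open>n i\<close> to the complement of \<open>n j\<close>; it is orthogonal to the edge\<close>
    let ?x = "n i - mink (n i) (n j) *\<^sub>R n j"
    have "mink ?x e = 0" using d by (simp add: e(2) n)
    moreover have "mink ?x (v i) \<noteq> 0" using n(3)[of i] n(2)[of i j] d by simp
    then have "?x \<noteq> 0" by (metis mink_linear(9))
    ultimately have "mink ?x ?x > 0" using e(1) spacelike_if_orthogonal_timelike by blast
    then have "(mink (n i) (n j))\<^sup>2 < 1"
      using n(1) by (simp add: power2_eq_square mink_commute[of "n j" "n i"])
    then show ?thesis by (simp add: abs_square_less_1)
  qed
  have angle: "dihedral_angle v i j = arccos (- mink (n k) (n l))" if "{i, j, k, l} = UNIV" for i j k l
    using n by (intro dihedral_angle_eq[OF det _ _ _ that]) auto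
  have \<alpha>nth: "\<alpha> $ edge_index i j = dihedral_angle v i j" if "i \<noteq> j" for i j
    using that unfolding \<alpha>_def by (intro edge_vector_nth dihedral_angle_commute)
  have G: "angle_gram \<alpha> $ i $ j = mink (n i) (n j)" for i j
  proof (cases "i = j")
    case True
    then show ?thesis by (simp add: angle_gram_diag n)
  next
    case False
    then obtain k l where kl: "{i, j, k, l} = UNIV" by (rule ex_distinct_edge)
    then have kl': "{k, l, i, j} = UNIV" by auto
    note d = distinct_if_UNIV_4[OF kl]
    have "angle_gram \<alpha> $ i $ j = - cos (arccos (- mink (n i) (n j)))"
      using d by (simp add: angle_gram_nth[OF kl] \<alpha>nth angle[OF kl'])
    then show ?thesis using nn[OF False] by (simp add: cos_arccos_abs)
  qed
  then have Ggram: "angle_gram \<alpha> = gram n" by (simp add: gram_def vec_eq_iff)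
  define H :: "real^4^4" where "H = (\<chi> i j. \<mu> i * \<mu> j * mink (v i) (v j))"
  have "(angle_gram \<alpha> ** H)$i$j = mat 1 $ i $ j" for i j
  proof -
    have "(angle_gram \<alpha> ** H)$i$j
        = (\<Sum>k\<in>UNIV. (\<mu> j / \<mu> i) * (mink (m i) (m k) * mink (v k) (v j)))"
      unfolding matrix_matrix_mult_def H_def G n_def
      using \<mu>(1) by (auto intro!: sum.cong simp: less_imp_neq[symmetric])
    also have "\<dots> = (if i = j then 1 else 0)"
      using \<mu>(1)[of j] unfolding sum_distrib_left[symmetric] sum_dual_gram[OF det m] by simp
    finally show ?thesis by (simp add: mat_def)
  qed
  then have GH: "angle_gram \<alpha> ** H = mat 1" by (simp add: vec_eq_iff)
  then have inv: "matrix_inv (angle_gram \<alpha>) = H" by (rule matrix_inv_eqI)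
  have "det (angle_gram \<alpha>) * det H = 1" by (simp add: GH flip: det_mul)
  then have "det (angle_gram \<alpha>) \<noteq> 0" by auto
  then have detG: "det (angle_gram \<alpha>) < 0" by (simp add: Ggram det_gram)
  have range: "0 < \<alpha> $ e \<and> \<alpha> $ e < pi" for e
  proof -
    obtain i j where e: "i \<noteq> j" "edge_index i j = e" using ex_edge_index by blast
    obtain k l where kl: "{i, j, k, l} = UNIV" using ex_distinct_edge[OF e(1)] .
    note d = distinct_if_UNIV_4[OF kl]
    have "\<alpha> $ e = arccos (- mink (n k) (n l))" using \<alpha>nth e angle[OF kl] by metis
    then show ?thesis using nn[of k l] d arccos_lt_bounded[of "- mink (n k) (n l)"] by auto
  qed
  show "realisable \<alpha>"
    using range detG nonideal neg \<mu>(1)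
    by (auto simp: realisable_def inv H_def mult_pos_neg less_imp_neq[symmetric])
  show "gram_matrix (dihedral_angle v) = angle_gram \<alpha>"
    unfolding \<alpha>_def by (rule gram_matrix_eq_angle_gram[OF dihedral_angle_commute])
  show "vertex_sign v k = - sgn (matrix_inv (angle_gram \<alpha>) $ k $ k)" for k
    using \<mu>(1)[of k] by (simp add: inv H_def vertex_sign_def sgn_mult)
  show "L i j = angle_len \<alpha> i j" if ij: "i \<noteq> j" for i j
  proof -
    obtain k l where kl: "{i, j, k, l} = UNIV" using ex_distinct_edge[OF ij] .
    then have kl': "{k, l, i, j} = UNIV" by auto
    note d = distinct_if_UNIV_4[OF kl]
    have "1 - (mink (n k) (n l))\<^sup>2 = det (angle_gram \<alpha>) * (H$i$i * H$j$j - H$i$j * H$j$i)"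
      using Jacobi_minor[OF GH kl'] n(1) by (simp add: G power2_eq_square mink_commute)
    moreover have "1 - (mink (n k) (n l))\<^sup>2 > 0"
      using nn[of k l] d by (simp add: abs_square_less_1)
    ultimately have "H$i$i * H$j$j - H$i$j * H$j$i < 0"
      using detG by (simp add: zero_less_mult_iff)
    moreover have "H$i$i * H$j$j - H$i$j * H$j$i
        = (\<mu> i * \<mu> j)\<^sup>2 * (mink (v i) (v i) * mink (v j) (v j) - (mink (v i) (v j))\<^sup>2)"
      by (simp add: H_def power2_eq_square mink_commute algebra_simps)
    ultimately have R: "(mink (v i) (v j))\<^sup>2 > mink (v i) (v i) * mink (v j) (v j)"
      by (simp add: mult_less_0_iff)
    have "angle_len \<alpha> i j
        = arc_len (\<mu> i * \<mu> j * mink (v i) (v j)) ((\<mu> i * \<mu> j)\<^sup>2 * (mink (v i) (v i) * mink (v j) (v j)))"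
      by (simp add: angle_len_def inv H_def power2_eq_square mult_ac)
    also have "\<dots> = arc_len (mink (v i) (v j)) (mink (v i) (v i) * mink (v j) (v j))"
      using \<mu>(1) by (intro arc_len_scale) simp
    finally show ?thesis
      using edge_length_eq[OF gen ij nonideal nonideal R nonempty[OF ij]] L[OF ij] by simp
  qed
qed

section \<open>Existence of tetrahedra with prescribed angles\<close>

text \<open>
  Gram-Schmidt orthogonalisation starting with the spacelike vector \<open>n 1\<close>. The first two vectors span a
  spacelike plane because \<open>\<bar>G\<^sub>1\<^sub>2\<bar> < 1\<close>. The sign of the third leading minor decides whether the
  third vector gets a spacelike or a timelike new component; as the determinant is negative, the
  fourth then gets one of the other kind.
\<close>

lemma gram_factorisation:
  fixes G :: "real^4^4"
  assumes sym: "\<And>i j. G$i$j = G$j$i" and diag: "\<And>i. G$i$i = 1"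
    and g12: "\<bar>G$1$2\<bar> < 1" and det: "det G < 0" and minor: "det (principal_submatrix G 4) \<noteq> 0"
  obtains n where "gram n = G"
proof -
  define a b c d e f where "a = G$1$2" and "b = G$1$3" and "c = G$1$4"
    and "d = G$2$3" and "e = G$2$4" and "f = G$3$4"
  note abbr = a_def[symmetric] b_def[symmetric] c_def[symmetric] d_def[symmetric]
    e_def[symmetric] f_def[symmetric]
  have sym': "G$2$1 = a" "G$3$1 = b" "G$4$1 = c" "G$3$2 = d" "G$4$2 = e" "G$4$3 = f"
    using sym by (simp_all add: abbr)
  have detG: "det G = 1 - a\<^sup>2 - b\<^sup>2 - c\<^sup>2 - d\<^sup>2 - e\<^sup>2 - f\<^sup>2 + a\<^sup>2 * f\<^sup>2 + b\<^sup>2 * e\<^sup>2 + c\<^sup>2 * d\<^sup>2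
      + 2 * a * b * d + 2 * a * c * e + 2 * b * c * f + 2 * d * e * f
      - 2 * a * b * e * f - 2 * a * c * d * f - 2 * b * c * d * e"
    by (simp add: det_4 diag sym' abbr) (simp add: power2_eq_square algebra_simps)
  have minorG: "det (principal_submatrix G 4) = 1 - a\<^sup>2 - b\<^sup>2 - d\<^sup>2 + 2 * a * b * d"
    by (simp add: det_3 principal_submatrix_def Let_def diag sym' abbr power2_eq_square)
  define r where "r = sqrt (1 - a\<^sup>2)"
  have r: "r > 0" "r\<^sup>2 = 1 - a\<^sup>2"
    using g12 by (simp_all add: r_def abbr abs_square_less_1 abs_square_le_1 less_imp_le)
  \<comment> \<open>the components of \<open>n 3\<close> and \<open>n 4\<close> along the second basis vector\<close>
  define y3 y4 where "y3 = (d - a * b) / r" and "y4 = (e - a * c) / r"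
  have y: "r * y3 = d - a * b" "r * y4 = e - a * c"
    using r by (simp_all add: y3_def y4_def)
  \<comment> \<open>the square of the component of \<open>n 3\<close> orthogonal to \<open>n 1\<close> and \<open>n 2\<close>\<close>
  define q where "q = 1 - b\<^sup>2 - y3\<^sup>2"
  define z where "z = f - b * c - y3 * y4"
  define \<rho> where "\<rho> = 1 - c\<^sup>2 - y4\<^sup>2 - z\<^sup>2 / q"
  have qr: "r\<^sup>2 * q = det (principal_submatrix G 4)"
  proof -
    have "r\<^sup>2 * y3\<^sup>2 = (d - a * b)\<^sup>2" unfolding y[symmetric] by (simp add: power2_eq_square)
    then show ?thesis
      unfolding minorG q_def right_diff_distrib r(2) by (simp add: power2_eq_square algebra_simps)
  qed
  then have q0: "q \<noteq> 0" using minor by auto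
  have qrho: "q * \<rho> = q * (1 - c\<^sup>2 - y4\<^sup>2) - z\<^sup>2"
    using q0 by (simp add: \<rho>_def field_simps)
  have y3: "r\<^sup>2 * y3\<^sup>2 = (d - a * b)\<^sup>2" and y4: "r\<^sup>2 * y4\<^sup>2 = (e - a * c)\<^sup>2"
    and y34: "r\<^sup>2 * (y3 * y4) = (d - a * b) * (e - a * c)"
    unfolding y[symmetric] by (simp_all add: power2_eq_square)
  have A: "r\<^sup>2 * q = (1 - a\<^sup>2) * (1 - b\<^sup>2) - (d - a * b)\<^sup>2"
    unfolding q_def using y3 r(2) by (simp add: right_diff_distrib)
  have B: "r\<^sup>2 * (1 - c\<^sup>2 - y4\<^sup>2) = (1 - a\<^sup>2) * (1 - c\<^sup>2) - (e - a * c)\<^sup>2"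
    using y4 r(2) by (simp add: right_diff_distrib)
  have C: "r\<^sup>2 * z = (1 - a\<^sup>2) * (f - b * c) - (d - a * b) * (e - a * c)"
    unfolding z_def using y34 r(2) by (simp add: right_diff_distrib)
  have "r\<^sup>2 * (r\<^sup>2 * (q * \<rho>)) = (r\<^sup>2 * q) * (r\<^sup>2 * (1 - c\<^sup>2 - y4\<^sup>2)) - (r\<^sup>2 * z)\<^sup>2"
    unfolding qrho by (simp add: power2_eq_square algebra_simps)
  also have "\<dots> = (1 - a\<^sup>2) * det G"
    unfolding A B C detG by (simp add: power2_eq_square algebra_simps)
  finally have "r\<^sup>2 * (r\<^sup>2 * (q * \<rho>)) = r\<^sup>2 * det G" by (simp add: r(2))
  then have "r\<^sup>2 * (q * \<rho>) = det G"
    using r(1) mult_left_cancel[of "r\<^sup>2" "r\<^sup>2 * (q * \<rho>)" "det G"] by (simp del: mult_cancel_left)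
  then have q\<rho>: "q * \<rho> < 0" using det r(1) by (smt (verit) mult_nonneg_nonneg zero_le_power2)
  define n :: "4 \<Rightarrow> real^4" where "n k =
     (if k = 1 then vector [1, 0, 0, 0] else if k = 2 then vector [a, r, 0, 0]
      else if q > 0 then
        (if k = 3 then vector [b, y3, sqrt q, 0] else vector [c, y4, z / sqrt q, sqrt (- \<rho>)])
      else
        (if k = 3 then vector [b, y3, 0, sqrt (- q)]
         else vector [c, y4, sqrt \<rho>, - z / sqrt (- q)]))" for k
  have ry: "a * b + r * y3 = d" "a * c + r * y4 = e" using y by simp_all
  have rr: "a * a + r * r = 1" using r(2) by (simp add: power2_eq_square)
  have "gram n $ i $ j = G $ i $ j" for i j
  proof (cases "q > 0")
    case True
    then have \<rho>: "\<rho> < 0" using q\<rho> by (simp add: mult_less_0_iff)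
    have zz: "z / sqrt q * (z / sqrt q) = z\<^sup>2 / q"
      using True by (simp add: power2_eq_square)
    have "\<forall>i j. gram n $ i $ j = G $ i $ j"
      using True \<rho> ry rr zz
      by (simp add: forall_4 gram_def n_def mink_def diag sym' abbr mult.commute)
        (simp add: \<rho>_def z_def q_def power2_eq_square)
    then show ?thesis by blast
  next
    case False
    then have q: "q < 0" using q0 by simp
    then have \<rho>: "\<rho> > 0" using q\<rho> by (simp add: mult_less_0_iff)
    have zz: "z / sqrt (- q) * (z / sqrt (- q)) = - z\<^sup>2 / q"
      using q by (simp add: power2_eq_square)
    have "\<forall>i j. gram n $ i $ j = G $ i $ j"
      using q \<rho> ry rr zz
      by (simp add: forall_4 gram_def n_def mink_def diag sym' abbr mult.commute)
        (simp add: \<rho>_def z_def q_def power2_eq_square)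
    then show ?thesis by blast
  qed
  then have "gram n = G" by (simp add: vec_eq_iff)
  then show ?thesis by (rule that)
qed


lemma det_nonzero_if_scaled:
  fixes m :: "'n \<Rightarrow> real^'n"
  assumes "det (\<chi> k. m k) \<noteq> 0" "\<And>k. c k \<noteq> 0"
  shows "det (\<chi> k. c k *\<^sub>R m k) \<noteq> 0"
  using assms det_rows_mul[of c m] by (simp add: scalar_mult_eq_scaleR)

lemma timelike_nth_4_nonzero: "mink x x < 0 \<Longrightarrow> x$4 \<noteq> 0"
  by (auto simp: mink_def) (smt (verit) zero_le_square)

text \<open>
  The timelike vectors considered here, the proper vertices and the sums of two ultra-ideal ones, have
  pairwise negative products. So they all lie in the same half of the light cone, which is turned into
  the future by a common sign. The family is nonempty since there are either proper vertices
  or two ultra-ideal ones.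
\<close>

lemma consistent_time_orientation:
  fixes w :: "4 \<Rightarrow> real^4"
  assumes neg: "\<And>i j. i \<noteq> j \<Longrightarrow> mink (w i) (w j) < 0"
    and unit: "\<And>i. mink (w i) (w i) = 1 \<or> mink (w i) (w i) = -1"
    and apart: "\<And>i j. i \<noteq> j \<Longrightarrow> mink (w i) (w i) = 1 \<Longrightarrow> mink (w j) (w j) = 1 \<Longrightarrow> mink (w i) (w j) < -1"
  shows "\<exists>\<sigma> :: real. (\<sigma> = 1 \<or> \<sigma> = -1) \<and>
    (\<forall>i. mink (w i) (w i) = -1 \<longrightarrow> (\<sigma> *\<^sub>R w i) $ 4 > 0) \<and>
    (\<forall>i j. i \<noteq> j \<longrightarrow> mink (w i) (w i) = 1 \<longrightarrow> mink (w j) (w j) = 1 \<longrightarrow> (\<sigma> *\<^sub>R (w i + w j)) $ 4 > 0)"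
proof -
  define T where "T = {w i | i. mink (w i) (w i) = -1} \<union>
    {w i + w j | i j. i \<noteq> j \<and> mink (w i) (w i) = 1 \<and> mink (w j) (w j) = 1}"
  have T: "mink x y < 0" if "x \<in> T" "y \<in> T" for x y
  proof -
    have 1: "mink (w i) (w k) < 0" if "mink (w i) (w i) = -1" "mink (w k) (w k) = -1" for i k
      using neg[of i k] that by (cases "i = k") auto
    have 2: "mink (w i) (w k + w l) < 0" "mink (w k + w l) (w i) < 0"
      if "mink (w i) (w i) = -1" "mink (w k) (w k) = 1" "mink (w l) (w l) = 1" for i k l
    proof -
      have "i \<noteq> k" "i \<noteq> l" using that by auto
      then show "mink (w i) (w k + w l) < 0" "mink (w k + w l) (w i) < 0"
        using neg[of i k] neg[of i l] neg[of k i] neg[of l i] by auto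
    qed
    have 3: "mink (w i + w j) (w k + w l) < 0"
      if "i \<noteq> j" "k \<noteq> l" "mink (w i) (w i) = 1" "mink (w j) (w j) = 1"
        "mink (w k) (w k) = 1" "mink (w l) (w l) = 1" for i j k l
    proof -
      have "mink (w a) (w b) = 1 \<and> a = b \<or> mink (w a) (w b) < -1 \<and> a \<noteq> b"
        if "mink (w a) (w a) = 1" "mink (w b) (w b) = 1" for a b
        using apart[of a b] that by (cases "a = b") auto
      from this[OF that(3,5)] this[OF that(3,6)] this[OF that(4,5)] this[OF that(4,6)] that(1,2)
      show ?thesis
        unfolding mink_linear by (smt (verit))
    qed
    show ?thesis using that 1 2 3 unfolding T_def by blast
  qed
  have "T \<noteq> {}"
  proof (cases "\<exists>i. mink (w i) (w i) = -1")
    case True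
    then show ?thesis by (auto simp: T_def)
  next
    case False
    then have "w 1 + w 2 \<in> T" using unit unfolding T_def
      by (intro UnI2 CollectI exI[of _ 1] exI[of _ 2]) auto
    then show ?thesis by auto
  qed
  then obtain e where e: "e \<in> T" by blast
  define \<sigma> where "\<sigma> = sgn (e$4)"
  have e4: "e$4 \<noteq> 0" using T[OF e e] by (rule timelike_nth_4_nonzero)
  then have \<sigma>: "\<sigma> = 1 \<or> \<sigma> = -1" by (auto simp: \<sigma>_def sgn_if)
  then have \<sigma>\<sigma>: "\<sigma> * \<sigma> = 1" by auto
  have pos: "(\<sigma> *\<^sub>R x) $ 4 > 0" if "x \<in> T" for x
  proof (rule future_directed)
    show "mink (\<sigma> *\<^sub>R x) (\<sigma> *\<^sub>R x) < 0" "mink (\<sigma> *\<^sub>R e) (\<sigma> *\<^sub>R e) \<le> 0" "mink (\<sigma> *\<^sub>R x) (\<sigma> *\<^sub>R e) < 0"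
      using T[OF that that] T[OF e e] T[OF that e] by (simp_all add: \<sigma>\<sigma> flip: mult.assoc)
    show "(\<sigma> *\<^sub>R e) $ 4 > 0" using e4 by (simp add: \<sigma>_def sgn_if)
  qed
  show ?thesis
    by (intro exI[of _ \<sigma>] conjI \<sigma> allI impI; rule pos) (auto simp: T_def)
qed

text \<open>
  The vertices are the negatives of the dual basis of the normals, normalised to squares \<open>\<plusminus>1\<close>. Polar
  planes of ultra-ideal vertices do not meet, because a common point would be orthogonal to the timelike
  sum of the two vertices.
\<close>

theorem realisable_imp_tetrahedron:
  assumes real: "realisable \<alpha>"
  obtains v L where "mildly_truncated v" "\<And>i j. i \<noteq> j \<Longrightarrow> edge_length v i j = ereal (L i j)"
    "edge_vector (dihedral_angle v) = \<alpha>"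
proof -
  define G where "G = angle_gram \<alpha>"
  define H where "H = matrix_inv G"
  have \<alpha>: "0 < \<alpha>$e" "\<alpha>$e < pi" and det: "det G < 0"
    and Hd: "H$i$i \<noteq> 0" and Ho: "i \<noteq> j \<Longrightarrow> H$i$j < 0" for e i j
    using real by (auto simp: realisable_def G_def H_def)
  have GH: "G ** H = mat 1" unfolding H_def using det by (intro matrix_inv_right) simp
  have Hsym: "H$i$j = H$j$i" for i j
    unfolding H_def using det by (intro matrix_inv_symmetric) (auto simp: G_def intro: angle_gram_symmetric)
  have Gless: "\<bar>G$i$j\<bar> < 1" if "i \<noteq> j" for i j
  proof -
    obtain k l where kl: "{i, j, k, l} = UNIV" using ex_distinct_edge[OF \<open>i \<noteq> j\<close>] .
    have "cos (\<alpha> $ edge_index k l) < cos 0"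
      using \<alpha> by (intro cos_monotone_0_pi) (auto intro: less_imp_le)
    moreover have "cos pi < cos (\<alpha> $ edge_index k l)"
      using \<alpha> by (intro cos_monotone_0_pi) (auto intro: less_imp_le)
    ultimately show ?thesis by (simp add: G_def angle_gram_nth[OF kl])
  qed
  obtain n where n: "gram n = G"
  proof (rule gram_factorisation)
    show "G$i$j = G$j$i" "G$i$i = 1" for i j
      unfolding G_def by (rule angle_gram_symmetric angle_gram_diag)+
    show "det (principal_submatrix G 4) \<noteq> 0"
      using det Hd by (simp add: det_principal_submatrix[OF GH])
  qed (use Gless det in auto)
  have Gn: "mink (n i) (n j) = G$i$j" for i j by (simp add: gram_def flip: n)
  have detn: "det (\<chi> k. n k) \<noteq> 0" using det det_gram[of n] n by auto
  obtain m where m: "dual_basis m n" and detm: "det (\<chi> k. m k) \<noteq> 0"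
    using dual_basis_exists[OF detn] .
  have "gram m ** G = mat 1" using gram_dual[OF detn m] n by simp
  then have "H = gram m" unfolding H_def by (intro matrix_inv_eqI) (simp add: matrix_left_right_inverse)
  then have mm: "mink (m i) (m j) = H$i$j" for i j by (simp add: gram_def)
  define h where "h k = sqrt \<bar>H$k$k\<bar>" for k
  have h: "h k > 0" "h k * h k = \<bar>H$k$k\<bar>" for k using Hd by (simp_all add: h_def)
  define w where "w k = (- (1 / h k)) *\<^sub>R m k" for k
  have ww: "mink (w i) (w j) = H$i$j / (h i * h j)" for i j by (simp add: w_def mm)
  have wd: "mink (w i) (w i) = sgn (H$i$i)" for i
    using h[of i] Hd[of i] by (simp add: ww sgn_if abs_if split: if_splits)
  have neg: "mink (w i) (w j) < 0" if "i \<noteq> j" for i j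
    using Ho[OF that] h by (simp add: ww divide_neg_pos)
  have R: "(mink (w i) (w j))\<^sup>2 > mink (w i) (w i) * mink (w j) (w j)" if ij: "i \<noteq> j" for i j
  proof -
    obtain k l where kl: "{i, j, k, l} = UNIV" using ex_distinct_edge[OF ij] .
    then have kl': "{k, l, i, j} = UNIV" by auto
    note d = distinct_if_UNIV_4[OF kl]
    have "1 - (G$k$l)\<^sup>2 = det G * (H$i$i * H$j$j - (H$i$j)\<^sup>2)"
      using Jacobi_minor[OF GH kl'] angle_gram_diag angle_gram_symmetric[of \<alpha> l k] Hsym[of j i]
      by (simp add: G_def power2_eq_square)
    moreover have "1 - (G$k$l)\<^sup>2 > 0" using Gless[of k l] d by (simp add: abs_square_less_1)
    ultimately have "H$i$i * H$j$j < (H$i$j)\<^sup>2" using det by (simp add: zero_less_mult_iff)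
    then have "H$i$i * H$j$j / (h i * h j)\<^sup>2 < (H$i$j)\<^sup>2 / (h i * h j)\<^sup>2"
      using h(1)[of i] h(1)[of j] by (simp add: divide_strict_right_mono)
    then show ?thesis by (simp add: ww power_divide power2_eq_square mult_ac)
  qed
  have apart: "mink (w i) (w j) < -1"
    if "i \<noteq> j" "mink (w i) (w i) = 1" "mink (w j) (w j) = 1" for i j
    using R[OF that(1)] neg[OF that(1)] that abs_le_square_iff[of "mink (w i) (w j)" 1] by auto
  have unit: "mink (w i) (w i) = 1 \<or> mink (w i) (w i) = -1" for i
    using Hd[of i] by (auto simp: wd sgn_if)
  obtain \<sigma> :: real where \<sigma>: "\<sigma> = 1 \<or> \<sigma> = -1"
    and \<sigma>p: "\<And>i. mink (w i) (w i) = -1 \<Longrightarrow> (\<sigma> *\<^sub>R w i) $ 4 > 0"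
    and \<sigma>u: "\<And>i j. i \<noteq> j \<Longrightarrow> mink (w i) (w i) = 1 \<Longrightarrow> mink (w j) (w j) = 1
      \<Longrightarrow> (\<sigma> *\<^sub>R (w i + w j)) $ 4 > 0"
    using consistent_time_orientation[of w] neg unit apart by auto
  have \<sigma>\<sigma>: "\<sigma> * \<sigma> = 1" "\<sigma> * (\<sigma> * x) = x" for x using \<sigma> by auto
  define v where "v k = \<sigma> *\<^sub>R w k" for k
  have vv: "mink (v i) (v j) = mink (w i) (w j)" for i j by (simp add: v_def \<sigma>\<sigma>)
  have detv: "det (\<chi> k. v k) \<noteq> 0"
    using det_nonzero_if_scaled[OF detm, of "\<lambda>k. \<sigma> * (- (1 / h k))"] \<sigma> h(1)
    by (auto simp: v_def w_def less_imp_neq[symmetric])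
  have gen: "generalised_tetrahedron v"
    unfolding generalised_tetrahedron_def
  proof (intro conjI allI impI)
    fix k assume "vertex_sign v k \<noteq> -1"
    then have "mink (w k) (w k) = -1" using unit[of k] by (auto simp: vertex_sign_eq_iff vv)
    then show "v k $ 4 > 0" unfolding v_def by (rule \<sigma>p)
  qed (use detv neg in \<open>auto simp: vv\<close>)
  have ultra: "mink (v i + v j) (v i + v j) < 0 \<and> (v i + v j) $ 4 > 0"
    if ij: "i \<noteq> j" and u: "mink (v i) (v i) > 0" "mink (v j) (v j) > 0" for i j
  proof -
    have u': "mink (w i) (w i) = 1" "mink (w j) (w j) = 1"
      using u unit[of i] unit[of j] by (auto simp: vv)
    have "mink (w j) (w i) < -1" using apart[of j i] ij u' by auto
    then show ?thesis
      using apart[OF ij u'] \<sigma>u[OF ij u'] u' by (simp add: vv) (simp add: v_def distrib_left)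
  qed
  have mild: "mildly_truncated v"
    unfolding mildly_truncated_def
  proof (intro conjI allI impI gen)
    fix i j assume ij: "i \<noteq> j \<and> vertex_sign v i = -1 \<and> vertex_sign v j = -1"
    show "polar_plane (v i) \<inter> polar_plane (v j) = {}"
    proof (rule ccontr)
      assume "polar_plane (v i) \<inter> polar_plane (v j) \<noteq> {}"
      then obtain x where x: "mink x x = -1" "mink x (v i) = 0" "mink x (v j) = 0"
        by (auto simp: polar_plane_def hyperbolic_space_def)
      have "mink x x > 0"
        using x ultra[of i j] ij by (intro spacelike_if_orthogonal_timelike[of "v i + v j"])
          (auto simp: vertex_sign_eq_iff)
      with x show False by simp
    qed
  qed
  have proper: "edge_part v i j \<noteq> {}" if "i \<noteq> j" "mink (v i) (v i) < 0" for i j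
  proof -
    have vi: "mink (w i) (w i) = -1" using that unit[of i] by (auto simp: vv)
    have "v i \<in> edge_part v i j"
    proof (rule mem_edge_partI[OF gen \<open>i \<noteq> j\<close>, where s = 1 and t = 0])
      show "v i \<in> hyperbolic_space"
        using vi \<sigma>p[OF vi] by (simp add: hyperbolic_space_def vv) (simp add: v_def)
    qed (use vi neg[OF that(1)] in \<open>auto simp: vv\<close>)
    then show ?thesis by blast
  qed
  have nonempty: "edge_part v i j \<noteq> {}" if ij: "i \<noteq> j" for i j
  proof -
    consider "mink (v i) (v i) < 0" | "mink (v j) (v j) < 0" | "mink (w i) (w i) = 1" "mink (w j) (w j) = 1"
      using unit[of i] unit[of j] by (auto simp: vv)
    then show ?thesis
    proof cases
      case 1
      then show ?thesis using proper ij by blast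
    next
      case 2
      then show ?thesis using proper[of j i] ij edge_part_commute[OF gen ij] by auto
    next
      case 3
      let ?z = "v i + v j"
      let ?c = "1 / sqrt (- mink ?z ?z)"
      have z: "mink ?z ?z < 0" "?z $ 4 > 0" using ultra[OF ij] 3 by (auto simp: vv)
      have c: "?c > 0" using z(1) by (simp del: mink_linear)
      have le: "mink ?z (v i) \<le> 0" "mink ?z (v j) \<le> 0"
        using apart[OF ij 3] apart[of j i] ij 3 by (auto simp: vv)
      have "?c *\<^sub>R ?z \<in> edge_part v i j"
      proof (rule mem_edge_partI[OF gen ij normalise_timelike[OF z] scaleR_add_right])
        show "mink (?c *\<^sub>R ?z) (v i) \<le> 0" "mink (?c *\<^sub>R ?z) (v j) \<le> 0"
          using c le by (simp_all only: mink_linear(5)) (simp_all only: mult_nonneg_nonpos less_imp_le)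
      qed (use c in simp_all)
      then show ?thesis by blast
    qed
  qed
  have len: "edge_length v i j
      = ereal (arc_len (mink (v i) (v j)) (mink (v i) (v i) * mink (v j) (v j)))" if ij: "i \<noteq> j" for i j
    using R[OF ij] unit[of i] unit[of j] nonempty[OF ij]
    by (intro edge_length_eq[OF gen ij]) (auto simp: vv)
  define n' where "n' k = \<sigma> *\<^sub>R n k" for k
  have mn: "mink (m i) (n j) = (if i = j then 1 else 0)" for i j using m by (simp add: dual_basis_def)
  have n'v: "mink (n' k) (v j) = (if j = k then - (1 / h k) else 0)" for k j
    by (simp add: n'_def v_def w_def \<sigma>\<sigma> mink_commute[of "n k"] mn)
  have n'n': "mink (n' i) (n' j) = G$i$j" for i j by (simp add: n'_def \<sigma>\<sigma> Gn)
  have angle: "dihedral_angle v i j = \<alpha> $ edge_index i j" if kl: "{i, j, k, l} = UNIV" for i j k l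
  proof -
    have kl': "{k, l, i, j} = UNIV" using kl by auto
    have "dihedral_angle v i j = arccos (- mink (n' k) (n' l))"
      using h(1) by (intro dihedral_angle_eq[OF detv _ _ _ kl])
        (auto simp: n'n' n'v G_def angle_gram_diag)
    also have "\<dots> = arccos (cos (\<alpha> $ edge_index i j))"
      by (simp add: n'n' G_def angle_gram_nth[OF kl'])
    also have "\<dots> = \<alpha> $ edge_index i j" using \<alpha> by (intro arccos_cos less_imp_le)
    finally show ?thesis .
  qed
  have "edge_vector (dihedral_angle v) $ e = \<alpha> $ e" for e
  proof -
    obtain i j where e: "i \<noteq> j" "edge_index i j = e" using ex_edge_index by blast
    obtain k l where kl: "{i, j, k, l} = UNIV" using ex_distinct_edge[OF e(1)] .
    show ?thesis
      using edge_vector_nth[of "dihedral_angle v" i j, OF dihedral_angle_commute e(1)] angle[OF kl] e(2)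
      by simp
  qed
  then have "edge_vector (dihedral_angle v) = \<alpha>" by (simp add: vec_eq_iff)
  with mild len show ?thesis by (rule that)
qed

section \<open>Differentiating the lengths\<close>

lemma differentiable_prod:
  fixes f :: "'i \<Rightarrow> 'a::real_normed_vector \<Rightarrow> real"
  assumes "\<And>i. i \<in> I \<Longrightarrow> f i differentiable (at a)"
  shows "(\<lambda>x. \<Prod>i\<in>I. f i x) differentiable (at a)"
  using assms by (induction I rule: infinite_finite_induct) (auto intro!: differentiable_mult)

lemma differentiable_det:
  fixes A :: "'a::real_normed_vector \<Rightarrow> real^'n^'n"
  assumes "\<And>i j. (\<lambda>x. A x $ i $ j) differentiable (at a)"
  shows "(\<lambda>x. det (A x)) differentiable (at a)"
  unfolding det_def
  by (intro differentiable_sum ballI finite_permutations differentiable_mult differentiable_const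
      differentiable_prod assms finite)

text \<open>
  Cramer's rule makes the entries of the inverse differentiable; their derivative is easier to
  obtain from the product rule.
\<close>

lemma matrix_inv_Cramer:
  fixes A :: "real^'n^'n"
  assumes "det A \<noteq> 0"
  shows "matrix_inv A $ k $ j = det (\<chi> r c. if c = k then (if r = j then 1 else 0) else A$r$c) / det A"
proof -
  have AH: "A ** matrix_inv A = mat 1" by (rule matrix_inv_right[OF assms])
  have "A *v column j (matrix_inv A) = column j (mat 1)"
    by (simp add: vec_eq_iff column_def matrix_vector_mult_def flip: AH)
      (simp add: matrix_matrix_mult_def)
  then have "column j (matrix_inv A) = (\<chi> k. det (\<chi> r c. if c = k then column j (mat 1) $ r else A$r$c) / det A)"
    by (simp add: cramer[OF assms])
  then have "column j (matrix_inv A) $ k = det (\<chi> r c. if c = k then column j (mat 1) $ r else A$r$c) / det A"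
    by simp
  then show ?thesis by (simp add: column_def mat_def cong: if_cong)
qed

lemma eventually_det_nonzero:
  fixes A :: "'a::real_normed_vector \<Rightarrow> real^'n^'n"
  assumes "\<And>i j. (\<lambda>x. A x $ i $ j) differentiable (at a)" "det (A a) \<noteq> 0"
  shows "\<forall>\<^sub>F x in nhds a. det (A x) \<noteq> 0"
proof -
  have "isCont (\<lambda>x. det (A x)) a"
    using differentiable_det[OF assms(1)] by (rule differentiable_imp_continuous_within)
  then have "((\<lambda>x. det (A x)) \<longlongrightarrow> det (A a)) (nhds a)"
    by (simp add: isCont_def tendsto_nhds_iff)
  then show ?thesis using assms(2) by (rule tendsto_imp_eventually_ne)
qed

text \<open>
  The formula \<open>d(A\<^sup>-\<^sup>1) = - A\<^sup>-\<^sup>1 dA A\<^sup>-\<^sup>1\<close>, by differentiating \<open>A A\<^sup>-\<^sup>1 = 1\<close>.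
\<close>

lemma has_derivative_matrix_inv:
  fixes A :: "'a::real_normed_vector \<Rightarrow> real^'n^'n"
  assumes A': "\<And>i j. ((\<lambda>x. A x $ i $ j) has_derivative A' i j) (at a)" and det: "det (A a) \<noteq> 0"
  shows "((\<lambda>x. matrix_inv (A x) $ p $ q) has_derivative
    (\<lambda>h. - (\<Sum>i\<in>UNIV. \<Sum>j\<in>UNIV. matrix_inv (A a) $ p $ i * A' i j h * matrix_inv (A a) $ j $ q))) (at a)"
proof -
  define H where "H x = matrix_inv (A x)" for x
  have dA: "(\<lambda>x. A x $ i $ j) differentiable (at a)" for i j
    using A' by (auto simp: differentiable_def)
  have ev: "\<forall>\<^sub>F x in nhds a. det (A x) \<noteq> 0" by (rule eventually_det_nonzero[OF dA det])
  have dif: "(\<lambda>x. H x $ p $ q) differentiable (at a)" for p q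
  proof -
    have "(\<lambda>x. (\<chi> r c. if c = p then (if r = q then 1 else 0) else A x $ r $ c) $ i $ j) differentiable (at a)" for i j
      using dA by (cases "j = p") simp_all
    then have "(\<lambda>x. det (\<chi> r c. if c = p then (if r = q then 1 else 0) else A x $ r $ c) / det (A x))
        differentiable (at a)"
      using det by (intro differentiable_divide differentiable_det dA)
    then obtain D where D: "((\<lambda>x. det (\<chi> r c. if c = p then (if r = q then 1 else 0) else A x $ r $ c) / det (A x))
        has_derivative D) (at a)" by (auto simp: differentiable_def)
    have "((\<lambda>x. H x $ p $ q) has_derivative D) (at a)"
    proof (rule has_derivative_transform_eventually[OF D])
      show "\<forall>\<^sub>F x in at a. det (\<chi> r c. if c = p then (if r = q then 1 else 0) else A x $ r $ c) / det (A x) = H x $ p $ q"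
        using ev unfolding eventually_at_filter by eventually_elim (simp add: H_def matrix_inv_Cramer)
    qed (simp_all add: H_def matrix_inv_Cramer det)
    then show ?thesis by (auto simp: differentiable_def)
  qed
  define H' where "H' p q = frechet_derivative (\<lambda>x. H x $ p $ q) (at a)" for p q
  have H': "((\<lambda>x. H x $ p $ q) has_derivative H' p q) (at a)" for p q
    using dif by (simp add: H'_def frechet_derivative_works)
  have AH: "(\<Sum>k\<in>UNIV. A x $ i $ k * H x $ k $ q) = (if i = q then 1 else 0)" if "det (A x) \<noteq> 0" for x i q
    using matrix_inv_right[OF that] by (simp add: H_def vec_eq_iff matrix_matrix_mult_def mat_def)
  have prod: "(\<Sum>k\<in>UNIV. A a $ i $ k * H' k q h + A' i k h * H a $ k $ q) = 0" for i q h
  proof -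
    have "((\<lambda>x. \<Sum>k\<in>UNIV. A x $ i $ k * H x $ k $ q) has_derivative
        (\<lambda>h. \<Sum>k\<in>UNIV. A a $ i $ k * H' k q h + A' i k h * H a $ k $ q)) (at a)"
      by (intro has_derivative_sum has_derivative_mult A' H')
    moreover have "((\<lambda>x. \<Sum>k\<in>UNIV. A x $ i $ k * H x $ k $ q) has_derivative (\<lambda>h. 0)) (at a)"
    proof (rule has_derivative_transform_eventually[OF has_derivative_const])
      show "\<forall>\<^sub>F x in at a. (if i = q then 1 else 0) = (\<Sum>k\<in>UNIV. A x $ i $ k * H x $ k $ q)"
        using ev unfolding eventually_at_filter by eventually_elim (simp add: AH)
    qed (simp_all add: AH det)
    ultimately have "(\<lambda>h. \<Sum>k\<in>UNIV. A a $ i $ k * H' k q h + A' i k h * H a $ k $ q) = (\<lambda>h. 0)"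
      by (rule has_derivative_unique)
    then show ?thesis by (rule fun_cong)
  qed
  have HA: "(\<Sum>i\<in>UNIV. H a $ p $ i * A a $ i $ k) = (if p = k then 1 else 0)" for k
    using matrix_inv_right[OF det]
    by (simp add: H_def matrix_left_right_inverse[of "A a"]) (simp add: vec_eq_iff matrix_matrix_mult_def mat_def)
  have "H' p q h = - (\<Sum>i\<in>UNIV. \<Sum>j\<in>UNIV. H a $ p $ i * A' i j h * H a $ j $ q)" for h
  proof -
    have "(\<Sum>i\<in>UNIV. H a $ p $ i * (\<Sum>k\<in>UNIV. A a $ i $ k * H' k q h + A' i k h * H a $ k $ q)) = 0"
      by (simp add: prod)
    then have "(\<Sum>i\<in>UNIV. \<Sum>k\<in>UNIV. H a $ p $ i * A a $ i $ k * H' k q h)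
        + (\<Sum>i\<in>UNIV. \<Sum>k\<in>UNIV. H a $ p $ i * A' i k h * H a $ k $ q) = 0"
      by (simp add: sum_distrib_left sum.distrib distrib_left mult.assoc)
    moreover have "(\<Sum>i\<in>UNIV. \<Sum>k\<in>UNIV. H a $ p $ i * A a $ i $ k * H' k q h)
        = (\<Sum>k\<in>UNIV. (\<Sum>i\<in>UNIV. H a $ p $ i * A a $ i $ k) * H' k q h)"
      by (subst sum.swap) (simp add: sum_distrib_right)
    moreover have "\<dots> = H' p q h" by (simp add: HA if_distrib[of "\<lambda>x. x * _"] cong: if_cong)
    ultimately show ?thesis by linarith
  qed
  then have "H' p q = (\<lambda>h. - (\<Sum>i\<in>UNIV. \<Sum>j\<in>UNIV. H a $ p $ i * A' i j h * H a $ j $ q))" by auto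
  with H'[of p q] show ?thesis by (simp add: H_def)
qed

text \<open>
  Near a point with \<open>p \<noteq> 0\<close> the sign of \<open>p\<close> is constant, and the length is
  \<open>ln (sqrt (w\<^sup>2 - p) - w) - ln \<bar>p\<bar> / 2\<close>. The two terms with \<open>p'\<close> combine because of
  \<open>p = (w - R) (w + R)\<close> for \<open>R = sqrt (w\<^sup>2 - p)\<close>.
\<close>

lemma has_derivative_arc_len:
  fixes w p :: "'a::real_normed_vector \<Rightarrow> real"
  assumes w: "(w has_derivative w') (at a)" and p: "(p has_derivative p') (at a)"
    and neg: "w a < 0" "p a \<noteq> 0" "p a < (w a)\<^sup>2"
  shows "((\<lambda>x. arc_len (w x) (p x)) has_derivative
    (\<lambda>h. (- w' h + w a * p' h / (2 * p a)) / sqrt ((w a)\<^sup>2 - p a))) (at a)"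
proof -
  define R where "R = sqrt ((w a)\<^sup>2 - p a)"
  have R: "R > 0" "R\<^sup>2 = (w a)\<^sup>2 - p a" using neg by (auto simp: R_def)
  then have pR: "p a = (w a - R) * (w a + R)" by (simp add: power2_eq_square algebra_simps)
  have Rw: "R - w a > 0" "R + w a \<noteq> 0" using R neg pR by auto
  have sgn: "\<forall>\<^sub>F x in nhds a. sgn (p x) = sgn (p a)"
  proof -
    have "isCont p a" using p by (rule has_derivative_continuous)
    then have t: "(p \<longlongrightarrow> p a) (nhds a)" by (simp add: isCont_def tendsto_nhds_iff)
    show ?thesis
    proof (cases "p a > 0")
      case True
      then show ?thesis using order_tendstoD(1)[OF t True] by (auto elim: eventually_mono)
    next
      case False
      then have "p a < 0" using neg by simp
      then show ?thesis using order_tendstoD(2)[OF t, of 0] by (auto elim!: eventually_mono)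
    qed
  qed
  define e where "e = sgn (p a)"
  have e: "e * p a > 0" "e \<noteq> 0" using neg(2) by (auto simp: e_def sgn_if)
  let ?u = "\<lambda>x. sqrt ((w x)\<^sup>2 - p x) - w x"
  have wp: "((\<lambda>x. (w x)\<^sup>2 - p x) has_derivative (\<lambda>h. 2 * w a * w' h - p' h)) (at a)"
    by (auto intro!: derivative_eq_intros w p)
  have u: "(?u has_derivative (\<lambda>h. (2 * w a * w' h - p' h) / (2 * R) - w' h)) (at a)"
    using neg(3) R(1)
    by (auto intro!: derivative_eq_intros w p simp: R_def divide_simps)
  have lnu: "((\<lambda>x. ln (?u x)) has_derivative
      (\<lambda>h. ((2 * w a * w' h - p' h) / (2 * R) - w' h) / (R - w a))) (at a)"
    by (rule has_derivative_eq_rhs[OF has_derivative_ln[OF _ u]])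
      (use Rw(1) in \<open>simp_all only: R_def divide_inverse mult.commute\<close>)
  have lne: "((\<lambda>x. ln (e * p x)) has_derivative (\<lambda>h. p' h / p a)) (at a)"
    using e by (auto intro!: derivative_eq_intros p simp: divide_simps)
  have "((\<lambda>x. ln (?u x) - ln (e * p x) / 2) has_derivative
    (\<lambda>h. ((2 * w a * w' h - p' h) / (2 * R) - w' h) / (R - w a) - p' h / p a / 2)) (at a)"
    by (intro has_derivative_diff lnu bounded_linear.has_derivative[OF bounded_linear_divide] lne)
  moreover have "((2 * w a * w' h - p' h) / (2 * R) - w' h) / (R - w a) - p' h / p a / 2
      = (- w' h + w a * p' h / (2 * p a)) / R" for h
  proof -
    have "((2 * w * w' - p') / (2 * R) - w') / (R - w) - p' / p / 2 = (- w' + w * p' / (2 * p)) / R"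
      if "R \<noteq> 0" "R - w \<noteq> 0" "p = w * w - R * R" "p \<noteq> 0" for w w' p p' R :: real
      using that by (simp add: field_simps) algebra
    from this[of R "w a" "p a"] show ?thesis
      using R Rw neg(2) by (simp add: power2_eq_square)
  qed
  ultimately have D: "((\<lambda>x. ln (?u x) - ln (e * p x) / 2) has_derivative
    (\<lambda>h. (- w' h + w a * p' h / (2 * p a)) / R)) (at a)" by simp
  have "isCont ?u a" using u by (rule has_derivative_continuous)
  then have "(?u \<longlongrightarrow> ?u a) (nhds a)" by (simp add: isCont_def tendsto_nhds_iff)
  then have evu: "\<forall>\<^sub>F x in nhds a. ?u x > 0"
    by (rule order_tendstoD(1)) (use Rw(1) in \<open>simp only: R_def\<close>)
  have ev: "\<forall>\<^sub>F x in nhds a. ln (?u x) - ln (e * p x) / 2 = arc_len (w x) (p x)"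
    using evu sgn
  proof eventually_elim
    case (elim x)
    have "e * p x = \<bar>p x\<bar>" using elim(2) by (simp add: e_def abs_sgn mult.commute)
    moreover have "p x \<noteq> 0" using elim(2) neg(2) by (metis sgn_0_0)
    ultimately show ?case using elim(1) by (simp add: arc_len_def ln_div ln_sqrt)
  qed
  show ?thesis
    unfolding R_def[symmetric]
    by (rule has_derivative_transform_eventually[OF D])
      (use ev eventually_nhds_x_imp_x[OF ev] in \<open>auto simp: eventually_at_filter elim: eventually_mono\<close>)
qed

lemma angle_gram_offdiag:
  assumes "i \<noteq> j"
  shows "angle_gram \<alpha> $ i $ j = - cos (\<alpha> $ opposite edge_index i j)"
proof -
  obtain k l where kl: "{i, j, k, l} = UNIV" using ex_distinct_edge[OF assms] .
  have "opposite edge_index i j = edge_index k l"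
    by (rule opposite_eq[OF edge_index_commute kl])
  then show ?thesis by (simp add: angle_gram_nth[OF kl])
qed

text \<open>
  The derivative of an entry of the Gram matrix in the direction \<open>h\<close>.
\<close>

definition angle_gram' :: "real^6 \<Rightarrow> 4 \<Rightarrow> 4 \<Rightarrow> real^6 \<Rightarrow> real" where
  "angle_gram' \<alpha> i j h =
     (if i = j then 0 else sin (\<alpha> $ opposite edge_index i j) * h $ opposite edge_index i j)"

lemma has_derivative_angle_gram:
  "((\<lambda>\<alpha>. angle_gram \<alpha> $ i $ j) has_derivative angle_gram' \<alpha> i j) (at \<alpha>)"
proof (cases "i = j")
  case True
  then show ?thesis by (simp add: angle_gram_diag angle_gram'_def [abs_def])
next
  case False
  let ?e = "opposite edge_index i j"
  have "((\<lambda>\<alpha>. \<alpha> $ ?e) has_derivative (\<lambda>h. h $ ?e)) (at \<alpha>)"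
    by (intro bounded_linear_imp_has_derivative bounded_linear_vec_nth)
  then have "((\<lambda>\<alpha>. - cos (\<alpha> $ ?e)) has_derivative (\<lambda>h. sin (\<alpha> $ ?e) * h $ ?e)) (at \<alpha>)"
    by (auto intro!: derivative_eq_intros)
  then show ?thesis using False by (simp add: angle_gram_offdiag angle_gram'_def [abs_def])
qed

definition inv_gram' :: "real^6 \<Rightarrow> 4 \<Rightarrow> 4 \<Rightarrow> real^6 \<Rightarrow> real" where
  "inv_gram' \<alpha> p q h = - (\<Sum>i\<in>UNIV. \<Sum>j\<in>UNIV. matrix_inv (angle_gram \<alpha>) $ p $ i
     * angle_gram' \<alpha> i j h * matrix_inv (angle_gram \<alpha>) $ j $ q)"

lemma has_derivative_inv_gram:
  assumes "det (angle_gram \<alpha>) \<noteq> 0"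
  shows "((\<lambda>\<alpha>. matrix_inv (angle_gram \<alpha>) $ p $ q) has_derivative inv_gram' \<alpha> p q) (at \<alpha>)"
  unfolding inv_gram'_def [abs_def]
  by (rule has_derivative_matrix_inv[OF has_derivative_angle_gram assms])

text \<open>
  All conditions are strict inequalities between continuous functions of the angles.
\<close>

lemma eventually_realisable:
  assumes "realisable \<alpha>"
  shows "\<forall>\<^sub>F \<beta> in nhds \<alpha>. realisable \<beta>"
proof -
  have det: "det (angle_gram \<alpha>) < 0" using assms by (simp add: realisable_def)
  have nth: "((\<lambda>\<beta>. \<beta> $ e) \<longlongrightarrow> \<alpha> $ e) (nhds \<alpha>)" for e
    by (intro tendsto_vec_nth tendsto_ident_at filterlim_ident)
  have inv: "((\<lambda>\<beta>. matrix_inv (angle_gram \<beta>) $ i $ j) \<longlongrightarrow> matrix_inv (angle_gram \<alpha>) $ i $ j) (nhds \<alpha>)" for i j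
    using has_derivative_continuous[OF has_derivative_inv_gram, of \<alpha> i j] det
    by (simp add: isCont_def tendsto_nhds_iff)
  have "(\<lambda>\<beta>. angle_gram \<beta> $ i $ j) differentiable (at \<alpha>)" for i j
    using has_derivative_angle_gram by (auto simp: differentiable_def)
  then have "isCont (\<lambda>\<beta>. det (angle_gram \<beta>)) \<alpha>"
    by (intro differentiable_imp_continuous_within differentiable_det)
  then have "((\<lambda>\<beta>. det (angle_gram \<beta>)) \<longlongrightarrow> det (angle_gram \<alpha>)) (nhds \<alpha>)"
    by (simp add: isCont_def tendsto_nhds_iff)
  then have 1: "\<forall>\<^sub>F \<beta> in nhds \<alpha>. det (angle_gram \<beta>) < 0" using det by (rule order_tendstoD(2))
  have 2: "\<forall>\<^sub>F \<beta> in nhds \<alpha>. \<forall>e. 0 < \<beta> $ e \<and> \<beta> $ e < pi"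
    using assms by (intro eventually_all_finite eventually_conj order_tendstoD[OF nth]) (auto simp: realisable_def)
  have 3: "\<forall>\<^sub>F \<beta> in nhds \<alpha>. \<forall>i. matrix_inv (angle_gram \<beta>) $ i $ i \<noteq> 0"
    using assms by (intro eventually_all_finite tendsto_imp_eventually_ne[OF inv]) (auto simp: realisable_def)
  have 4: "\<forall>\<^sub>F \<beta> in nhds \<alpha>. \<forall>i j. i \<noteq> j \<longrightarrow> matrix_inv (angle_gram \<beta>) $ i $ j < 0"
  proof (intro eventually_all_finite)
    fix i j :: 4
    show "\<forall>\<^sub>F \<beta> in nhds \<alpha>. i \<noteq> j \<longrightarrow> matrix_inv (angle_gram \<beta>) $ i $ j < 0"
      using order_tendstoD(2)[OF inv[of i j], of 0] assms by (cases "i = j") (auto simp: realisable_def)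
  qed
  show ?thesis using 1 2 3 4 by eventually_elim (simp add: realisable_def)
qed

lemma edge_vector_cong:
  "(\<And>i j. i \<noteq> j \<Longrightarrow> f i j = g i j) \<Longrightarrow> edge_vector f = edge_vector g"
  by (simp add: edge_vector_def)

text \<open>
  The description in the definition is proper: a tetrahedron exists, and its lengths depend on the angles alone.
\<close>

lemma edge_length_map_eq:
  assumes "realisable \<alpha>"
  shows "edge_length_map \<alpha> = edge_vector (angle_len \<alpha>)"
  unfolding edge_length_map_def
proof (rule the_equality)
  obtain v L where v: "mildly_truncated v" "\<And>i j. i \<noteq> j \<Longrightarrow> edge_length v i j = ereal (L i j)"
    "edge_vector (dihedral_angle v) = \<alpha>"
    using realisable_imp_tetrahedron[OF assms] by blast
  have "edge_vector L = edge_vector (angle_len \<alpha>)"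
    using lengths_from_angles(3)[OF v(1,2)] v(3) by (intro edge_vector_cong) auto
  then show "\<exists>v L. mildly_truncated v \<and> (\<forall>i j. i \<noteq> j \<longrightarrow> edge_length v i j = ereal (L i j)) \<and>
      edge_vector (dihedral_angle v) = \<alpha> \<and> edge_vector (angle_len \<alpha>) = edge_vector L"
    using v by metis
next
  fix x
  assume "\<exists>v L. mildly_truncated v \<and> (\<forall>i j. i \<noteq> j \<longrightarrow> edge_length v i j = ereal (L i j)) \<and>
      edge_vector (dihedral_angle v) = \<alpha> \<and> x = edge_vector L"
  then obtain v L where v: "mildly_truncated v" "\<And>i j. i \<noteq> j \<Longrightarrow> edge_length v i j = ereal (L i j)"
    "edge_vector (dihedral_angle v) = \<alpha>" "x = edge_vector L" by blast
  then show "x = edge_vector (angle_len \<alpha>)"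
    using lengths_from_angles(3)[OF v(1,2)] by (auto intro!: edge_vector_cong)
qed

text \<open>
  The condition that the polar planes of two ultra-ideal vertices are disjoint, like the reverse
  Cauchy-Schwarz inequality for proper vertices, is thereby a consequence of \<open>det G < 0\<close> and of the
  angles lying strictly between \<open>0\<close> and \<open>\<pi>\<close>.
\<close>

lemma realisable_discriminant:
  assumes "realisable \<alpha>" and kl: "{i, j, k, l} = UNIV"
  defines "H \<equiv> matrix_inv (angle_gram \<alpha>)"
  shows "(sin (\<alpha> $ edge_index k l))\<^sup>2 = - det (angle_gram \<alpha>) * ((H$k$l)\<^sup>2 - H$k$k * H$l$l)"
    and "H$k$k * H$l$l < (H$k$l)\<^sup>2"
proof -
  have det: "det (angle_gram \<alpha>) < 0" and \<alpha>: "0 < \<alpha> $ e" "\<alpha> $ e < pi" for e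
    using assms by (auto simp: realisable_def)
  have GH: "angle_gram \<alpha> ** H = mat 1"
    unfolding H_def using det by (intro matrix_inv_right) simp
  have sym: "H$l$k = H$k$l"
    unfolding H_def using det by (intro matrix_inv_symmetric angle_gram_symmetric) simp
  show 1: "(sin (\<alpha> $ edge_index k l))\<^sup>2 = - det (angle_gram \<alpha>) * ((H$k$l)\<^sup>2 - H$k$k * H$l$l)"
    using Jacobi_minor[OF GH kl] angle_gram_symmetric[of \<alpha> j i]
    unfolding sin_squared_eq
    by (simp add: angle_gram_diag angle_gram_nth[OF kl] sym power2_eq_square algebra_simps)
  have "sin (\<alpha> $ edge_index k l) > 0" using \<alpha> by (intro sin_gt_zero)
  then have "- det (angle_gram \<alpha>) * ((H$k$l)\<^sup>2 - H$k$k * H$l$l) > 0"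
    unfolding 1[symmetric] by (rule zero_less_power)
  then show "H$k$k * H$l$l < (H$k$l)\<^sup>2" using det by (simp add: zero_less_mult_iff mult_less_0_iff)
qed

definition angle_len' :: "real^6 \<Rightarrow> 4 \<Rightarrow> 4 \<Rightarrow> real^6 \<Rightarrow> real" where
  "angle_len' \<alpha> p q h = (let H = matrix_inv (angle_gram \<alpha>) in
     (- inv_gram' \<alpha> p q h + H$p$q / 2 * (inv_gram' \<alpha> p p h / H$p$p + inv_gram' \<alpha> q q h / H$q$q))
       / sqrt ((H$p$q)\<^sup>2 - H$p$p * H$q$q))"

lemma has_derivative_angle_len:
  assumes real: "realisable \<alpha>" and pq: "p \<noteq> q"
  shows "((\<lambda>\<alpha>. angle_len \<alpha> p q) has_derivative angle_len' \<alpha> p q) (at \<alpha>)"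
proof -
  define H where "H = matrix_inv (angle_gram \<alpha>)"
  have det: "det (angle_gram \<alpha>) \<noteq> 0" and neg: "H$p$q < 0" and ne: "H$p$p \<noteq> 0" "H$q$q \<noteq> 0"
    using real pq by (auto simp: realisable_def H_def)
  obtain i j where "{p, q, i, j} = UNIV" using ex_distinct_edge[OF pq] .
  then have kl: "{i, j, p, q} = UNIV" by auto
  note D = has_derivative_inv_gram[OF det]
  have "((\<lambda>\<alpha>. arc_len (matrix_inv (angle_gram \<alpha>) $ p $ q)
      (matrix_inv (angle_gram \<alpha>) $ p $ p * matrix_inv (angle_gram \<alpha>) $ q $ q)) has_derivative
    (\<lambda>h. (- inv_gram' \<alpha> p q h
        + H$p$q * (H$p$p * inv_gram' \<alpha> q q h + inv_gram' \<alpha> p p h * H$q$q) / (2 * (H$p$p * H$q$q)))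
      / sqrt ((H$p$q)\<^sup>2 - H$p$p * H$q$q))) (at \<alpha>)"
    using has_derivative_arc_len[OF D[of p q] has_derivative_mult[OF D[of p p] D[of q q]]]
      neg ne realisable_discriminant(2)[OF real kl]
    by (simp add: H_def)
  moreover have "(- inv_gram' \<alpha> p q h
        + H$p$q * (H$p$p * inv_gram' \<alpha> q q h + inv_gram' \<alpha> p p h * H$q$q) / (2 * (H$p$p * H$q$q)))
      / sqrt ((H$p$q)\<^sup>2 - H$p$p * H$q$q) = angle_len' \<alpha> p q h" for h
  proof -
    have "H$p$q * (H$p$p * inv_gram' \<alpha> q q h + inv_gram' \<alpha> p p h * H$q$q) / (2 * (H$p$p * H$q$q))
      = H$p$q / 2 * (inv_gram' \<alpha> p p h / H$p$p + inv_gram' \<alpha> q q h / H$q$q)"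
      using ne by (simp add: field_simps)
    then show ?thesis by (simp add: angle_len'_def Let_def flip: H_def)
  qed
  ultimately show ?thesis by (simp add: angle_len_def Let_def)
qed

lemma edge_index_pairs: "\<exists>p q. p \<noteq> q \<and> (\<forall>f. edge_vector f $ e = f p q)"
proof -
  consider "e = 1" | "e = 2" | "e = 3" | "e = 4" | "e = 5" | "e = 6" using exhaust_6 by blast
  then show ?thesis
  proof cases
    case 1 show ?thesis by (intro exI[of _ 1] exI[of _ 2]) (simp add: 1 edge_vector_def)
  next
    case 2 show ?thesis by (intro exI[of _ 1] exI[of _ 3]) (simp add: 2 edge_vector_def)
  next
    case 3 show ?thesis by (intro exI[of _ 1] exI[of _ 4]) (simp add: 3 edge_vector_def)
  next
    case 4 show ?thesis by (intro exI[of _ 2] exI[of _ 3]) (simp add: 4 edge_vector_def)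
  next
    case 5 show ?thesis by (intro exI[of _ 2] exI[of _ 4]) (simp add: 5 edge_vector_def)
  next
    case 6 show ?thesis by (intro exI[of _ 3] exI[of _ 4]) (simp add: 6 edge_vector_def)
  qed
qed

lemma has_derivative_edge_vector:
  assumes "\<And>p q. p \<noteq> q \<Longrightarrow> ((\<lambda>x. f x p q) has_derivative f' p q) (at a)"
  shows "((\<lambda>x. edge_vector (f x)) has_derivative (\<lambda>h. edge_vector (\<lambda>p q. f' p q h))) (at a)"
proof -
  have "((\<lambda>x. edge_vector (f x) $ e) has_derivative (\<lambda>h. edge_vector (\<lambda>p q. f' p q h) $ e)) (at a)" for e
  proof -
    obtain p q where pq: "p \<noteq> q" "\<And>f :: 4 \<Rightarrow> 4 \<Rightarrow> real. edge_vector f $ e = f p q"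
      using edge_index_pairs[of e] by blast
    then show ?thesis using assms by simp
  qed
  then show ?thesis
    by (subst has_derivative_componentwise_within) (auto simp: Basis_vec_def inner_axis)
qed

theorem has_derivative_edge_length_map:
  assumes "realisable \<alpha>"
  shows "(edge_length_map has_derivative (\<lambda>h. edge_vector (\<lambda>p q. angle_len' \<alpha> p q h))) (at \<alpha>)"
proof (rule has_derivative_transform_eventually)
  show "((\<lambda>\<beta>. edge_vector (angle_len \<beta>)) has_derivative (\<lambda>h. edge_vector (\<lambda>p q. angle_len' \<alpha> p q h))) (at \<alpha>)"
    by (intro has_derivative_edge_vector has_derivative_angle_len assms)
  show "\<forall>\<^sub>F \<beta> in at \<alpha>. edge_vector (angle_len \<beta>) = edge_length_map \<beta>"
    using eventually_realisable[OF assms] unfolding eventually_at_filter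
    by eventually_elim (simp add: edge_length_map_eq)
qed (simp_all add: edge_length_map_eq assms)

section \<open>The entries of the Jacobian matrix\<close>

lemma edge_index_eq_iff:
  assumes "a \<noteq> b" "k \<noteq> l"
  shows "edge_index a b = edge_index k l \<longleftrightarrow> {a, b} = {k, l}"
proof -
  have "\<forall>a b k l. a \<noteq> b \<longrightarrow> k \<noteq> l \<longrightarrow> edge_index a b = edge_index k l \<longrightarrow> {a, b} = {k, l}"
    by (simp add: forall_4 edge_index_def doubleton_eq_iff)
  then have "edge_index a b = edge_index k l \<Longrightarrow> {a, b} = {k, l}" using assms by blast
  moreover have "{a, b} = {k, l} \<Longrightarrow> edge_index a b = edge_index k l"
    using edge_index_commute[of a b] by (auto simp: doubleton_eq_iff)
  ultimately show ?thesis by blast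
qed

lemma edge_index_values:
  "edge_index 1 2 = 1" "edge_index 1 3 = 2" "edge_index 1 4 = 3"
  "edge_index 2 3 = 4" "edge_index 2 4 = 5" "edge_index 3 4 = 6"
  by (simp_all add: edge_index_def doubleton_eq_iff)

text \<open>
  The angle at the edge \<open>k l\<close> occurs only in the entries \<open>(i, j)\<close> and \<open>(j, i)\<close> of the Gram matrix.
\<close>

lemma angle_gram'_axis:
  assumes kl: "{i, j, k, l} = UNIV"
  shows "angle_gram' \<alpha> a b (axis (edge_index k l) 1)
    = (if a = i \<and> b = j \<or> a = j \<and> b = i then sin (\<alpha> $ edge_index k l) else 0)"
proof (cases "a = b")
  case True
  then show ?thesis using distinct_if_UNIV_4[OF kl] by (auto simp: angle_gram'_def)
next
  case False
  then obtain c d where cd: "{a, b, c, d} = UNIV" by (rule ex_distinct_edge)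
  note d1 = distinct_if_UNIV_4[OF cd] and d2 = distinct_if_UNIV_4[OF kl]
  have opp: "opposite edge_index a b = edge_index c d"
    by (rule opposite_eq[OF edge_index_commute cd])
  have "{c, d} = UNIV - {a, b}" "{k, l} = UNIV - {i, j}" using cd kl d1 d2 by auto
  then have "{c, d} = {k, l} \<longleftrightarrow> {a, b} = {i, j}"
    by (metis double_diff subset_UNIV)
  then have "edge_index c d = edge_index k l \<longleftrightarrow> a = i \<and> b = j \<or> a = j \<and> b = i"
    using d1 d2 by (simp add: edge_index_eq_iff doubleton_eq_iff)
  then show ?thesis using False by (auto simp: angle_gram'_def opp axis_def)
qed

lemma inv_gram'_axis:
  fixes i j k l :: 4 and \<alpha> :: "real^6"
  assumes kl: "{i, j, k, l} = UNIV"
  defines "H \<equiv> matrix_inv (angle_gram \<alpha>)"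
  shows "inv_gram' \<alpha> p q (axis (edge_index k l) 1)
    = - sin (\<alpha> $ edge_index k l) * (H$p$i * H$j$q + H$p$j * H$i$q)"
proof -
  note d = distinct_if_UNIV_4[OF kl]
  let ?s = "sin (\<alpha> $ edge_index k l)"
  have "inv_gram' \<alpha> p q (axis (edge_index k l) 1)
    = - (\<Sum>a\<in>UNIV. \<Sum>b\<in>UNIV. H$p$a * (if a = i \<and> b = j \<or> a = j \<and> b = i then ?s else 0) * H$b$q)"
    unfolding inv_gram'_def angle_gram'_axis[OF kl] H_def ..
  also have "(\<lambda>a b. H$p$a * (if a = i \<and> b = j \<or> a = j \<and> b = i then ?s else 0) * H$b$q)
    = (\<lambda>a b. (if b = j then if a = i then H$p$i * ?s * H$j$q else 0 else 0)
        + (if b = i then if a = j then H$p$j * ?s * H$i$q else 0 else 0))"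
    using d by (auto simp: fun_eq_iff)
  finally show ?thesis by (simp add: sum.distrib algebra_simps)
qed

lemma omega_eq:
  assumes "{i, j, k, l} = UNIV"
  shows "omega \<epsilon> L k l = (let s = sigma' \<epsilon> L in
    (- s i k * s j l + \<epsilon> l * s i l * s j l * s k l
     - s i l * s j k + \<epsilon> k * s i k * s j k * s k l) / (sigma \<epsilon> L k l)\<^sup>2)"
proof -
  have kl: "{k, l, i, j} = UNIV" using assms by auto
  show ?thesis unfolding omega_def by (rule opposite_eq[OF _ kl]) (simp add: Let_def algebra_simps)
qed

text \<open>
  The entries of \<open>H\<close> are normalised by \<open>h\<close>. In \<open>S\<close> the diagonal is set to the signs of the
  vertices, so that \<open>H\<^sub>i\<^sub>j = - h\<^sub>i h\<^sub>j S\<^sub>i\<^sub>j\<close> holds for all \<open>i\<close> and \<open>j\<close> (\<open>H_eq\<close>).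
\<close>

locale realisable_angles =
  fixes \<alpha> :: "real^6"
  assumes realisable: "realisable \<alpha>"
begin

abbreviation "G \<equiv> angle_gram \<alpha>"
definition H :: "real^4^4" where "H = matrix_inv G"

definition h :: "4 \<Rightarrow> real" where "h k = sqrt \<bar>H $ k $ k\<bar>"

definition eps :: "4 \<Rightarrow> real" where "eps k = - sgn (H $ k $ k)"

abbreviation "s \<equiv> sigma' eps (angle_len \<alpha>)"
abbreviation "\<sigma> \<equiv> sigma eps (angle_len \<alpha>)"
abbreviation "w \<equiv> omega eps (angle_len \<alpha>)"

definition S :: "4 \<Rightarrow> 4 \<Rightarrow> real" where "S i j = (if i = j then eps i else s i j)"

definition R :: "4 \<Rightarrow> 4 \<Rightarrow> real" where "R i j = sqrt ((H$i$j)\<^sup>2 - H$i$i * H$j$j)"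

lemma det: "det G < 0" and Hd: "H$i$i \<noteq> 0" and Ho: "i \<noteq> j \<Longrightarrow> H$i$j < 0"
  using realisable by (auto simp: realisable_def H_def)

lemma GH: "G ** H = mat 1" unfolding H_def using det by (intro matrix_inv_right) simp

lemma H_sym: "H$i$j = H$j$i"
  unfolding H_def using det by (intro matrix_inv_symmetric angle_gram_symmetric) simp

lemma h_pos: "h k > 0" and h_sq: "h k * h k = \<bar>H$k$k\<bar>"
  using Hd[of k] by (auto simp: h_def)

lemma eps_sq: "eps k * eps k = 1"
  using Hd[of k] by (auto simp: eps_def sgn_if)

lemma disc: "i \<noteq> j \<Longrightarrow> H$i$i * H$j$j < (H$i$j)\<^sup>2"
proof -
  assume "i \<noteq> j"
  then obtain k l where "{i, j, k, l} = UNIV" by (rule ex_distinct_edge)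
  then have "{k, l, i, j} = UNIV" by auto
  then show ?thesis unfolding H_def by (rule realisable_discriminant(2)[OF realisable])
qed

lemma R_pos: "i \<noteq> j \<Longrightarrow> R i j > 0"
  using disc by (simp add: R_def)

lemma sin_eq:
  assumes kl: "{i, j, k, l} = UNIV"
  shows "sin (\<alpha> $ edge_index k l) = sqrt (- det G) * R k l"
proof -
  have "0 \<le> sin (\<alpha> $ edge_index k l)"
    using realisable by (intro sin_ge_zero) (auto simp: realisable_def intro: less_imp_le)
  then have "sin (\<alpha> $ edge_index k l) = sqrt ((sin (\<alpha> $ edge_index k l))\<^sup>2)" by simp
  also have "\<dots> = sqrt (- det G) * R k l"
    unfolding realisable_discriminant(1)[OF realisable kl] real_sqrt_mult R_def H_def ..
  finally show ?thesis .
qed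

lemma exp_len:
  assumes "i \<noteq> j"
  shows "exp (angle_len \<alpha> i j) = (R i j - H$i$j) / (h i * h j)"
    and "eps i * eps j * exp (- angle_len \<alpha> i j) = (- R i j - H$i$j) / (h i * h j)"
proof -
  have hh: "h i * h j = sqrt \<bar>H$i$i * H$j$j\<bar>" by (simp add: h_def real_sqrt_mult abs_mult)
  have ss: "eps i * eps j = sgn (H$i$i * H$j$j)" by (simp add: eps_def sgn_mult)
  have L: "angle_len \<alpha> i j = arc_len (H$i$j) (H$i$i * H$j$j)" by (simp add: angle_len_def H_def Let_def)
  note e = exp_arc_len[OF Ho[OF assms] _ disc[OF assms]]
  show "exp (angle_len \<alpha> i j) = (R i j - H$i$j) / (h i * h j)"
    unfolding L hh R_def using Hd by (intro e(1)) simp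
  show "eps i * eps j * exp (- angle_len \<alpha> i j) = (- R i j - H$i$j) / (h i * h j)"
    unfolding L hh R_def ss using Hd by (intro e(2)) simp
qed

lemma s_eq: "i \<noteq> j \<Longrightarrow> s i j = - H$i$j / (h i * h j)"
  unfolding sigma'_def mult.assoc using exp_len[of i j]
  by (simp add: mult.assoc diff_divide_distrib)

lemma \<sigma>_eq: "i \<noteq> j \<Longrightarrow> \<sigma> i j = R i j / (h i * h j)"
  unfolding sigma_def mult.assoc using exp_len[of i j]
  by (simp add: mult.assoc diff_divide_distrib)

lemma \<sigma>_pos: "i \<noteq> j \<Longrightarrow> \<sigma> i j > 0"
  using h_pos R_pos by (simp add: \<sigma>_eq)

lemma H_eq: "H$i$j = - (h i * h j * S i j)"
proof (cases "i = j")
  case True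
  then show ?thesis by (simp add: S_def eps_def h_sq sgn_if abs_if)
next
  case False
  then show ?thesis using h_pos[of i] h_pos[of j] by (simp add: S_def s_eq)
qed

lemma R_eq: "i \<noteq> j \<Longrightarrow> R i j = h i * h j * \<sigma> i j"
  using h_pos[of i] h_pos[of j] by (simp add: \<sigma>_eq)

lemma S_sym: "S i j = S j i"
  using H_sym[of i j] h_pos[of i] h_pos[of j] by (simp add: H_eq)

text \<open>
  This is \<open>cosh\<^sup>2 - sinh\<^sup>2 = 1\<close>, with the signs of the two ends.
\<close>

lemma \<sigma>_sq: "i \<noteq> j \<Longrightarrow> \<sigma> i j * \<sigma> i j = S i j * S i j - eps i * eps j"
  by (simp add: S_def sigma_def sigma'_def field_simps mult_exp_exp) 

text \<open>
  The principal minor at \<open>i\<close> is \<open>H\<^sub>i\<^sub>i det G\<close>, of the sign \<open>eps i\<close>.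
\<close>

lemma eta_eq:
  assumes kl: "{i, j, k, l} = UNIV"
  shows "eta eps G = sqrt (- det G) * (h i * h j * h k * h l)"
proof -
  have "eps i * det (principal_submatrix G i) = - det G * (h i * h i)" for i
    unfolding h_sq det_principal_submatrix[OF GH]
    by (simp add: eps_def abs_sgn)
  then have "(\<Prod>i\<in>UNIV. eps i * det (principal_submatrix G i)) / (- det G) ^ 3
      = - det G * (\<Prod>i\<in>UNIV. h i)\<^sup>2"
    using det by (simp add: prod_4 power2_eq_square power3_eq_cube)
  then have "eta eps G = sqrt (- det G) * (\<Prod>i\<in>UNIV. h i)"
    unfolding eta_def real_sqrt_mult using h_pos
    by (simp only: real_sqrt_mult real_sqrt_abs) (simp add: prod_nonneg less_imp_le)
  also have "(\<Prod>i\<in>UNIV. h i) = h i * h j * h k * h l"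
    unfolding kl[symmetric] using distinct_if_UNIV_4[OF kl] by (simp add: mult.assoc)
  finally show ?thesis .
qed

definition J :: "4 \<Rightarrow> 4 \<Rightarrow> 4 \<Rightarrow> 4 \<Rightarrow> real" where
  "J p q k l = angle_len' \<alpha> p q (axis (edge_index k l) 1)"

text \<open>
  The derivative of \<open>H\<close> is inserted into the derivative of the length, and all entries of \<open>H\<close> are
  written as \<open>- h\<^sub>a h\<^sub>b S\<^sub>a\<^sub>b\<close>. The factors \<open>h p\<close> and \<open>h q\<close> cancel, and \<open>h i\<close>, \<open>h j\<close>, \<open>h k\<close>, \<open>h l\<close>
  combine with the sine of the angle into \<open>eta\<close>.
\<close>

lemma J_eq:
  assumes kl: "{i, j, k, l} = UNIV" and pq: "p \<noteq> q"
  shows "J p q k l = eta eps G * \<sigma> k l / \<sigma> p q *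
    (S p i * S j q + S p j * S i q - S p q * (eps p * S p i * S p j + eps q * S q i * S q j))"
proof -
  note d = distinct_if_UNIV_4[OF kl]
  let ?\<delta> = "sqrt (- det G)"
  have "J p q k l = ?\<delta> * R k l / R p q *
      (H$p$i * H$j$q + H$p$j * H$i$q - H$p$q * (H$p$i * H$p$j / H$p$p + H$q$i * H$q$j / H$q$q))"
  proof -
    have "(- (- (t * c) * (a + a')) + x / 2 * (- (t * c) * b' / P + - (t * c) * d' / Q)) / r
        = t * c / r * (a + a' - x * (b / P + d / Q))"
      if "b' = 2 * b" "d' = 2 * d" "P \<noteq> 0" "Q \<noteq> 0" "r \<noteq> 0" for t c a a' x b b' d d' P Q r :: real
      using that by (simp add: field_simps)
    note expand = this
    show ?thesis
      unfolding J_def angle_len'_def Let_def inv_gram'_axis[OF kl] sin_eq[OF kl]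
        H_def[symmetric] R_def[symmetric]
      by (rule expand)
        (use H_sym[of j p] H_sym[of i p] H_sym[of j q] H_sym[of i q] Hd R_pos[OF pq] in simp_all)
  qed
  also have "\<dots> = ?\<delta> * (h k * h l * \<sigma> k l) / (h p * h q * \<sigma> p q) *
      (h p * h q * h i * h j * (S p i * S j q + S p j * S i q
        - S p q * (eps p * S p i * S p j + eps q * S q i * S q j)))"
  proof -
    have 1: "H$p$i * H$p$j / H$p$p = - (h i * h j * (eps p * S p i * S p j))" for p
    proof -
      have "H$p$p = - (h p * h p * eps p)" by (simp add: H_eq S_def)
      moreover have "eps p = 1 \<or> eps p = -1" using eps_sq[of p] by (simp add: square_eq_1_iff)
      ultimately show ?thesis using h_pos[of p] by (auto simp: H_eq[of p i] H_eq[of p j])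
    qed
    show ?thesis unfolding 1 R_eq[OF pq] R_eq[OF d(6)]
      by (simp add: H_eq algebra_simps)
  qed
  also have "\<dots> = eta eps G * \<sigma> k l / \<sigma> p q *
    (S p i * S j q + S p j * S i q - S p q * (eps p * S p i * S p j + eps q * S q i * S q j))"
    using h_pos[of p] h_pos[of q] by (simp add: eta_eq[OF kl])
  finally show ?thesis .
qed

text \<open>
  Here the polynomial in \<open>J_eq\<close> is the negative of the numerator of \<open>omega\<close>.
\<close>

lemma J_same:
  assumes kl: "{i, j, k, l} = UNIV"
  shows "J k l k l = - eta eps G * (\<sigma> k l * w k l * \<sigma> k l)"
proof -
  note d = distinct_if_UNIV_4[OF kl]
  have w: "w k l * (\<sigma> k l * \<sigma> k l) = - S i k * S j l + eps l * S i l * S j l * S k l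
    - S i l * S j k + eps k * S i k * S j k * S k l"
    unfolding omega_eq[OF kl] Let_def using \<sigma>_pos[OF d(6)] d by (simp add: S_def power2_eq_square)
  have "J k l k l = eta eps G * (- (w k l * (\<sigma> k l * \<sigma> k l)))"
    unfolding J_eq[OF kl d(6)] w using \<sigma>_pos[OF d(6)] S_sym[of k i] S_sym[of k j] S_sym[of l i] S_sym[of l j]
    by (simp add: algebra_simps)
  then show ?thesis by (simp add: algebra_simps)
qed

lemma J_adjacent:
  assumes kl: "{i, j, k, l} = UNIV"
  shows "J k i k l = - eta eps G * (\<sigma> k i * (eps k * s k j) * \<sigma> k l)"
proof -
  note d = distinct_if_UNIV_4[OF kl]
  have ki: "k \<noteq> i" using d by simp
  have "S k i * S j i + S k j * S i i - S k i * (eps k * S k i * S k j + eps i * S i i * S i j)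
    = - (eps k * S k j * (\<sigma> k i * \<sigma> k i))"
    unfolding \<sigma>_sq[OF ki] using S_sym[of j i] eps_sq[of k] eps_sq[of i]
    by (simp add: S_def[of i i] algebra_simps)
  then show ?thesis
    unfolding J_eq[OF kl ki] using \<sigma>_pos[OF ki] d by (simp add: S_def[of k j] mult_ac)
qed

lemma J_opposite:
  assumes kl: "{i, j, k, l} = UNIV"
  shows "J i j k l = - eta eps G * (\<sigma> i j * 1 * \<sigma> k l)"
proof -
  note d = distinct_if_UNIV_4[OF kl]
  have "S i i * S j j + S i j * S i j - S i j * (eps i * S i i * S i j + eps j * S j i * S j j)
    = - (\<sigma> i j * \<sigma> i j)"
    unfolding \<sigma>_sq[OF d(1)] using S_sym[of j i] eps_sq[of i] eps_sq[of j]
    by (simp add: S_def[of i i] S_def[of j j] algebra_simps)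
  then show ?thesis
    unfolding J_eq[OF kl d(1)] using \<sigma>_pos[OF d(1)] by simp
qed


lemma \<sigma>_sym: "\<sigma> i j = \<sigma> j i"
  unfolding sigma_def angle_len_def Let_def using H_sym[unfolded H_def, of i j]
  by (simp add: mult.commute mult.left_commute)

lemma s_sym: "i \<noteq> j \<Longrightarrow> s i j = s j i"
  using S_sym[of i j] by (simp add: S_def)

lemma J_commute:
  assumes "p \<noteq> q" "k \<noteq> l"
  shows "J p q k l = J q p k l"
proof -
  obtain i j where "{k, l, i, j} = UNIV" using ex_distinct_edge[OF assms(2)] .
  then have kl: "{i, j, k, l} = UNIV" by auto
  show ?thesis
    unfolding J_eq[OF kl assms(1)] J_eq[OF kl assms(1)[symmetric]] \<sigma>_sym[of q p]
    using S_sym[of p q] S_sym[of q i] S_sym[of q j] S_sym[of p i] S_sym[of p j]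
    by (simp add: algebra_simps)
qed

lemma J_commute': "J p q k l = J p q l k"
  by (simp add: J_def edge_index_commute[of k l])

lemma entry_same:
  assumes "edge_index k l = e" "k \<noteq> l"
  shows "angle_len' \<alpha> k l (axis e 1) = - eta eps G * (\<sigma> k l * w k l * \<sigma> k l)"
proof -
  obtain i j where "{k, l, i, j} = UNIV" using ex_distinct_edge[OF assms(2)] .
  then have kl: "{i, j, k, l} = UNIV" by auto
  then show ?thesis using J_same[OF kl] assms(1) by (simp add: J_def)
qed

lemma entry_opposite:
  assumes "edge_index k l = e" "{p, q, k, l} = UNIV"
  shows "angle_len' \<alpha> p q (axis e 1) = - eta eps G * (\<sigma> p q * 1 * \<sigma> k l)"
  using J_opposite[OF assms(2)] assms(1) by (simp add: J_def)

text \<open>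
  The position of the common vertex \<open>c\<close> in the two edges is arbitrary here, as needed for the order
  in which edges index rows and columns.
\<close>

lemma entry_adjacent:
  assumes e: "edge_index k l = e" and c: "{p, q} \<inter> {k, l} = {c}" and j: "{p, q, k, l, j} = UNIV"
  shows "angle_len' \<alpha> p q (axis e 1) = - eta eps G * (\<sigma> p q * (eps c * s c j) * \<sigma> k l)"
proof -
  have 1: "J c i c m = - eta eps G * (\<sigma> c i * (eps c * s c j) * \<sigma> c m)"
    "J i c c m = - eta eps G * (\<sigma> i c * (eps c * s c j) * \<sigma> c m)"
    "J c i m c = - eta eps G * (\<sigma> c i * (eps c * s c j) * \<sigma> m c)"
    "J i c m c = - eta eps G * (\<sigma> i c * (eps c * s c j) * \<sigma> m c)"
    if "{i, j, c, m} = UNIV" for i m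
    using J_adjacent[OF that] distinct_if_UNIV_4[OF that]
    by (simp_all add: J_commute[of i c] J_commute'[of _ _ m c] \<sigma>_sym[of i c] \<sigma>_sym[of m c])
  have "c \<in> {p, q} \<inter> {k, l}" unfolding c by simp
  then consider "p = c" "k = c" | "p = c" "l = c" | "q = c" "k = c" | "q = c" "l = c" by auto
  then show ?thesis
    unfolding e[symmetric] J_def[symmetric]
    by cases (use j in \<open>simp add: 1 insert_commute\<close>)+
qed

text \<open>
  A variant for the entries that are written with \<open>c\<close> as the second index.
\<close>

lemma entry_adjacent':
  assumes "edge_index k l = e" "{p, q} \<inter> {k, l} = {c}" "{p, q, k, l, j} = UNIV"
  shows "angle_len' \<alpha> p q (axis e 1) = - eta eps G * (\<sigma> p q * (eps c * s j c) * \<sigma> k l)"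
proof -
  have "s j c = s c j" by (cases "j = c") (simp_all add: s_sym)
  then show ?thesis using entry_adjacent[OF assms] by simp
qed

lemma diag_conjugation: "(diag_matrix d ** M ** diag_matrix d) $ a $ b = d $ a * M $ a $ b * d $ b"
proof -
  have 1: "(diag_matrix d ** N) $ a $ b = d $ a * N $ a $ b" for N b
    by (simp add: matrix_matrix_mult_def diag_matrix_def if_distrib[of "\<lambda>x. x * _"] cong: if_cong)
  have 2: "(N ** diag_matrix d) $ a $ b = N $ a $ b * d $ b" for N
    by (simp add: matrix_matrix_mult_def diag_matrix_def if_distrib[of "\<lambda>x. _ * x"] cong: if_cong)
  show ?thesis by (simp add: 1 2)
qed

text \<open>
  Each of the 36 entries is an instance of one of the three cases.
\<close>

lemma jacobian_edge_length_map:
  "jacobian edge_length_map (at \<alpha>)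
    = - eta eps G *\<^sub>R (D_matrix eps (angle_len \<alpha>) ** S_matrix eps (angle_len \<alpha>) ** D_matrix eps (angle_len \<alpha>))"
proof -
  let ?L = "angle_len \<alpha>"
  have "frechet_derivative edge_length_map (at \<alpha>) = (\<lambda>h. edge_vector (\<lambda>p q. angle_len' \<alpha> p q h))"
    using frechet_derivative_at[OF has_derivative_edge_length_map[OF realisable]] ..
  then have "jacobian edge_length_map (at \<alpha>) $ a $ b = edge_vector (\<lambda>p q. angle_len' \<alpha> p q (axis b 1)) $ a" for a b
    by (simp add: jacobian_def matrix_def)
  moreover have "\<forall>a b. edge_vector (\<lambda>p q. angle_len' \<alpha> p q (axis b 1)) $ a
      = - eta eps G * (edge_vector \<sigma> $ a * S_matrix eps ?L $ a $ b * edge_vector \<sigma> $ b)"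
    unfolding forall_6 edge_vector_def S_matrix_def Let_def vector_6
    by (intro conjI; (rule entry_same entry_opposite entry_adjacent entry_adjacent';
        (rule edge_index_values | simp; fail | auto simp: UNIV_4; fail)))
  ultimately show ?thesis
    by (simp add: vec_eq_iff D_matrix_def diag_conjugation)
qed

end

lemma S_matrix_cong:
  assumes "\<And>i j. i \<noteq> j \<Longrightarrow> L i j = L' i j"
  shows "S_matrix \<epsilon> L = S_matrix \<epsilon> L'"
proof -
  have s: "sigma' \<epsilon> L i j = sigma' \<epsilon> L' i j" "sigma \<epsilon> L i j = sigma \<epsilon> L' i j" if "i \<noteq> j" for i j
    using assms[OF that] by (simp_all add: sigma'_def sigma_def)
  have "omega \<epsilon> L k l = omega \<epsilon> L' k l" if ne: "k \<noteq> l" for k l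
  proof -
    obtain i j where "{k, l, i, j} = UNIV" using ex_distinct_edge[OF ne] .
    then have kl: "{i, j, k, l} = UNIV" by auto
    show ?thesis unfolding omega_eq[OF kl] using distinct_if_UNIV_4[OF kl] by (simp add: s Let_def)
  qed
  then show ?thesis by (simp add: S_matrix_def Let_def s)
qed

theorem theorem6:
  fixes v :: "4 \<Rightarrow> real^4" and L :: "4 \<Rightarrow> 4 \<Rightarrow> real"
  assumes "mildly_truncated v"
    and "\<And>i j. i \<noteq> j \<Longrightarrow> edge_length v i j = ereal (L i j)"
  shows "edge_length_map differentiable (at (edge_vector (dihedral_angle v))) \<and>
    jacobian edge_length_map (at (edge_vector (dihedral_angle v))) =
      - eta (vertex_sign v) (gram_matrix (dihedral_angle v)) *\<^sub>R
        (D_matrix (vertex_sign v) L ** S_matrix (vertex_sign v) L ** D_matrix (vertex_sign v) L)"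
proof
  let ?\<alpha> = "edge_vector (dihedral_angle v)"
  note angles = lengths_from_angles[OF assms]
  interpret realisable_angles ?\<alpha> by unfold_locales (rule angles(1))
  show "edge_length_map differentiable (at ?\<alpha>)"
    using has_derivative_edge_length_map[OF angles(1)] by (auto simp: differentiable_def)
  have "vertex_sign v = eps"
    by (rule ext) (simp add: angles(4) eps_def H_def)
  moreover have "S_matrix eps L = S_matrix eps (angle_len ?\<alpha>)"
    using angles(3) by (rule S_matrix_cong)
  moreover have "D_matrix eps L = D_matrix eps (angle_len ?\<alpha>)"
    using angles(3) by (simp add: D_matrix_def edge_vector_def sigma_def)
  ultimately show "jacobian edge_length_map (at ?\<alpha>) =
      - eta (vertex_sign v) (gram_matrix (dihedral_angle v)) *\<^sub>R
        (D_matrix (vertex_sign v) L ** S_matrix (vertex_sign v) L ** D_matrix (vertex_sign v) L)"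
    using jacobian_edge_length_map angles(2) by simp
qed

end
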